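(* Let $A$ be a closed densely defined symmetric operator in a separable Hilbert space $\mathfrak H$ with equal deficiency indices and $A\ge a_0I_{\mathfrak H}$ for some $a_0>0$. Let $\{\mathcal H,\Gamma_0,\Gamma_1\}$ be a boundary triplet for $A^*$ such that $A_0:=A^*\restriction\ker\Gamma_0$ is the Friedrichs extension of $A$, and let $M$ be its Weyl function (so $M(0)\in\mathcal B(\mathcal H)$). Let $\Theta=\Theta^*$ be a closed linear relation in $\mathcal H$ such that $A_\Theta:=A^*\restriction\{f\in\operatorname{dom}A^*:\{\Gamma_0f,\Gamma_1f\}\in\Theta\}$ (which is self-adjoint) is lower semibounded. Then \[\inf\sigma_{\rm ess}(A_\Theta)\ge0\iff\inf\sigma_{\rm ess}(\Theta-M(0))\ge0,\] \[\inf\sigma_{\rm ess}(A_\Theta)>0\iff\inf\sigma_{\rm ess}(\Theta-M(0))>0,\] \[\inf\sigma_{\rm ess}(A_\Theta)=0\iff\inf\sigma_{\rm ess}(\Theta-M(0))=0.\]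
   Context: Boundary triplet: a triple $\{\mathcal H,\Gamma_0,\Gamma_1\}$ with $\mathcal H$ a Hilbert space and $\Gamma_0,\Gamma_1:\operatorname{dom}(A^* )\to\mathcal H$ linear such that $(A^*f,g)-(f,A^*g)=(\Gamma_1f,\Gamma_0g)_{\mathcal H}-(\Gamma_0f,\Gamma_1g)_{\mathcal H}$ for all $f,g\in\operatorname{dom}A^*$ and $f\mapsto\{\Gamma_0f,\Gamma_1f\}$ maps onto $\mathcal H\times\mathcal H$. Weyl function: $M(z)=\Gamma_1(\Gamma_0\restriction\ker(A^*-z))^{-1}$, $z\in\rho(A_0)$. A linear relation is a linear subspace of $\mathcal H\times\mathcal H$; $\Theta^*=\{\{\tilde f,\tilde g\}:(g,\tilde f)=(f,\tilde g)\ \forall\{f,g\}\in\Theta\}$; sum with an operator: $\Theta-M(0)=\{\{f,g-M(0)f\}:\{f,g\}\in\Theta\}$. For a self-adjoint relation, the spectrum and essential spectrum are those of its operator part (the self-adjoint operator in $\overline{\operatorname{dom}\Theta}$ obtained after splitting off $\{0\}\times\operatorname{mul}\Theta$, $\operatorname{mul}\Theta=\{g:\{0,g\}\in\Theta\}$). *)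

theory Defs
  imports "HOL-Analysis.Analysis"
begin

text \<open>A complex Hilbert space is modelled as a real Hilbert space (type class
  real_inner + complete_space) together with an orthogonal complex structure J
  (multiplication by the imaginary unit).\<close>

definition cplx_str :: "('a::real_inner \<Rightarrow> 'a) \<Rightarrow> bool" where
  "cplx_str J \<longleftrightarrow> linear J \<and> (\<forall>x. J (J x) = - x) \<and> (\<forall>x y. inner (J x) (J y) = inner x y)"

definition cscale :: "('a::real_vector \<Rightarrow> 'a) \<Rightarrow> complex \<Rightarrow> 'a \<Rightarrow> 'a" where
  "cscale J z x = Re z *\<^sub>R x + Im z *\<^sub>R J x"

text \<open>Complex inner product, linear in the first and antilinear in the second argument.\<close>
definition cinner :: "('a::real_inner \<Rightarrow> 'a) \<Rightarrow> 'a \<Rightarrow> 'a \<Rightarrow> complex" where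
  "cinner J x y = Complex (inner x y) (- inner (J x) y)"

definition separable_type :: "'a::topological_space itself \<Rightarrow> bool" where
  "separable_type _ \<longleftrightarrow> (\<exists>D::'a set. countable D \<and> closure D = UNIV)"

definition lin_rel :: "('a::real_vector \<Rightarrow> 'a) \<Rightarrow> ('a \<times> 'a) set \<Rightarrow> bool" where
  "lin_rel J T \<longleftrightarrow> subspace T \<and> (\<forall>f g. (f, g) \<in> T \<longrightarrow> (J f, J g) \<in> T)"

definition rdom :: "('a \<times> 'a) set \<Rightarrow> 'a set" where
  "rdom T = fst ` T"

definition rmul :: "('a::zero \<times> 'a) set \<Rightarrow> 'a set" where
  "rmul T = {g. (0, g) \<in> T}"

definition radj :: "('a::real_inner \<Rightarrow> 'a) \<Rightarrow> ('a \<times> 'a) set \<Rightarrow> ('a \<times> 'a) set" where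
  "radj J T = {(a, b). \<forall>f g. (f, g) \<in> T \<longrightarrow> cinner J g a = cinner J f b}"

definition self_adjoint_rel :: "('a::real_inner \<Rightarrow> 'a) \<Rightarrow> ('a \<times> 'a) set \<Rightarrow> bool" where
  "self_adjoint_rel J T \<longleftrightarrow> radj J T = T"

definition symmetric_rel :: "('a::real_inner \<Rightarrow> 'a) \<Rightarrow> ('a \<times> 'a) set \<Rightarrow> bool" where
  "symmetric_rel J T \<longleftrightarrow> T \<subseteq> radj J T"

definition bounded_below_by :: "('a::real_inner \<Rightarrow> 'a) \<Rightarrow> ('a \<times> 'a) set \<Rightarrow> real \<Rightarrow> bool" where
  "bounded_below_by J T c \<longleftrightarrow> (\<forall>f g. (f, g) \<in> T \<longrightarrow> Re (cinner J g f) \<ge> c * (norm f)\<^sup>2)"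

definition lower_semibounded :: "('a::real_inner \<Rightarrow> 'a) \<Rightarrow> ('a \<times> 'a) set \<Rightarrow> bool" where
  "lower_semibounded J T \<longleftrightarrow> (\<exists>c. bounded_below_by J T c)"

definition cdds_operator :: "('a::real_inner \<Rightarrow> 'a) \<Rightarrow> ('a \<times> 'a) set \<Rightarrow> bool" where
  "cdds_operator J A \<longleftrightarrow> lin_rel J A \<and> closed A \<and> rmul A = {0}
     \<and> closure (rdom A) = UNIV \<and> symmetric_rel J A"

definition defect :: "('a::real_inner \<Rightarrow> 'a) \<Rightarrow> ('a \<times> 'a) set \<Rightarrow> complex \<Rightarrow> 'a set" where
  "defect J A z = {f. (f, cscale J z f) \<in> radj J A}"

text \<open>Equal deficiency indices: the defect subspaces for i and -i have the same
  Hilbert dimension, i.e. are unitarily equivalent.\<close>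
definition equal_deficiency :: "('a::real_inner \<Rightarrow> 'a) \<Rightarrow> ('a \<times> 'a) set \<Rightarrow> bool" where
  "equal_deficiency J A \<longleftrightarrow> (\<exists>U. bij_betw U (defect J A \<i>) (defect J A (- \<i>))
     \<and> (\<forall>x\<in>defect J A \<i>. \<forall>y\<in>defect J A \<i>. cinner J (U x) (U y) = cinner J x y))"

definition form_approx :: "('a::real_inner \<Rightarrow> 'a) \<Rightarrow> ('a \<times> 'a) set \<Rightarrow> 'a \<Rightarrow> (nat \<Rightarrow> 'a \<times> 'a) \<Rightarrow> bool" where
  "form_approx J A f p \<longleftrightarrow> (\<forall>n. p n \<in> A) \<and> (\<lambda>n. fst (p n)) \<longlonglongrightarrow> f \<and>
     (\<forall>e>0. \<exists>N. \<forall>m\<ge>N. \<forall>n\<ge>N.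
        Re (cinner J (snd (p n) - snd (p m)) (fst (p n) - fst (p m))) < e)"

text \<open>The Friedrichs extension: the operator associated with the closure of the form
  t[f,g] = (Af,g), dom t = dom A.  For f, g in the domain of the closed form with
  form-approximating sequences p, q, the closed form is
  lim (A (fst (p n)), fst (q n)).\<close>
definition friedrichs :: "('a::real_inner \<Rightarrow> 'a) \<Rightarrow> ('a \<times> 'a) set \<Rightarrow> ('a \<times> 'a) set" where
  "friedrichs J A = {(f, h). (\<exists>p. form_approx J A f p) \<and>
     (\<forall>p. form_approx J A f p \<longrightarrow> (\<forall>g q. form_approx J A g q \<longrightarrow>
        (\<lambda>n. cinner J (snd (p n)) (fst (q n))) \<longlonglongrightarrow> cinner J h g))}"

definition clinear_on :: "('a::real_vector \<Rightarrow> 'a) \<Rightarrow> ('b::real_vector \<Rightarrow> 'b) \<Rightarrow> 'a set \<Rightarrow> ('a \<Rightarrow> 'b) \<Rightarrow> bool" where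
  "clinear_on J K S G \<longleftrightarrow> (\<forall>f\<in>S. \<forall>g\<in>S. G (f + g) = G f + G g) \<and>
     (\<forall>f\<in>S. \<forall>z. G (cscale J z f) = cscale K z (G f))"

definition boundary_triplet ::
  "('a::real_inner \<Rightarrow> 'a) \<Rightarrow> ('b::real_inner \<Rightarrow> 'b) \<Rightarrow> ('a \<times> 'a) set \<Rightarrow> ('a \<Rightarrow> 'b) \<Rightarrow> ('a \<Rightarrow> 'b) \<Rightarrow> bool" where
  "boundary_triplet J K A G0 G1 \<longleftrightarrow>
     clinear_on J K (rdom (radj J A)) G0 \<and> clinear_on J K (rdom (radj J A)) G1 \<and>
     (\<forall>f f' g g'. (f, f') \<in> radj J A \<longrightarrow> (g, g') \<in> radj J A \<longrightarrow>
        cinner J f' g - cinner J f g' = cinner K (G1 f) (G0 g) - cinner K (G0 f) (G1 g)) \<and>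
     (\<lambda>f. (G0 f, G1 f)) ` rdom (radj J A) = UNIV"

definition ext_A0 :: "('a::real_inner \<Rightarrow> 'a) \<Rightarrow> ('a \<times> 'a) set \<Rightarrow> ('a \<Rightarrow> 'b::zero) \<Rightarrow> ('a \<times> 'a) set" where
  "ext_A0 J A G0 = {(f, g). (f, g) \<in> radj J A \<and> G0 f = 0}"

text \<open>The Weyl function at z = 0 (as a linear relation/graph):
  M(0) = Gamma_1 (Gamma_0 restricted to ker A*)^{-1}.\<close>
definition weyl0 :: "('a::real_inner \<Rightarrow> 'a) \<Rightarrow> ('a \<times> 'a) set \<Rightarrow> ('a \<Rightarrow> 'b) \<Rightarrow> ('a \<Rightarrow> 'b) \<Rightarrow> ('b \<times> 'b) set" where
  "weyl0 J A G0 G1 = {(G0 f, G1 f) | f. (f, 0) \<in> radj J A}"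

definition ext_Theta :: "('a::real_inner \<Rightarrow> 'a) \<Rightarrow> ('a \<times> 'a) set \<Rightarrow> ('a \<Rightarrow> 'b) \<Rightarrow> ('a \<Rightarrow> 'b) \<Rightarrow> ('b \<times> 'b) set \<Rightarrow> ('a \<times> 'a) set" where
  "ext_Theta J A G0 G1 Th = {(f, g). (f, g) \<in> radj J A \<and> (G0 f, G1 f) \<in> Th}"

definition rel_minus :: "('b::ab_group_add \<times> 'b) set \<Rightarrow> ('b \<times> 'b) set \<Rightarrow> ('b \<times> 'b) set" where
  "rel_minus Th M = {(f, g - k) | f g k. (f, g) \<in> Th \<and> (f, k) \<in> M}"

text \<open>Operator part: the operator in closure(dom T) obtained by splitting off {0} x mul T.\<close>
definition op_part :: "('a::real_normed_vector \<times> 'a) set \<Rightarrow> ('a \<times> 'a) set" where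
  "op_part T = {(f, g). (f, g) \<in> T \<and> g \<in> closure (rdom T)}"

text \<open>Spectrum of a self-adjoint relation (real, since self-adjoint): the spectrum of its
  operator part T_op in H_0 = closure (dom T); lambda is in the resolvent set iff
  T_op - lambda maps onto H_0 and has a bounded inverse.\<close>
definition sa_spectrum :: "('a::real_normed_vector \<times> 'a) set \<Rightarrow> real set" where
  "sa_spectrum T = {l. \<not> ((\<forall>h\<in>closure (rdom T). \<exists>f. (f, h + l *\<^sub>R f) \<in> op_part T) \<and>
      (\<exists>C. \<forall>f g. (f, g) \<in> op_part T \<longrightarrow> norm f \<le> C * norm (g - l *\<^sub>R f)))}"

definition eigenspace_rel :: "('a::real_normed_vector \<times> 'a) set \<Rightarrow> real \<Rightarrow> 'a set" where
  "eigenspace_rel T l = {f. (f, l *\<^sub>R f) \<in> op_part T}"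

definition sa_disc_spectrum :: "('a::real_normed_vector \<times> 'a) set \<Rightarrow> real set" where
  "sa_disc_spectrum T = {l \<in> sa_spectrum T.
      (\<exists>e>0. sa_spectrum T \<inter> {l - e<..<l + e} = {l}) \<and>
      (\<exists>B. finite B \<and> eigenspace_rel T l \<subseteq> span B)}"

definition sa_ess_spectrum :: "('a::real_normed_vector \<times> 'a) set \<Rightarrow> real set" where
  "sa_ess_spectrum T = sa_spectrum T - sa_disc_spectrum T"

text \<open>Infimum of the essential spectrum in the extended reals (inf of the empty set is +\<infinity>).\<close>
definition inf_ess :: "('a::real_normed_vector \<times> 'a) set \<Rightarrow> ereal" where
  "inf_ess T = Inf (ereal ` sa_ess_spectrum T)"

end

(* Write A_Theta^{-1} = A_0^{-1} + gamma T^{-1} gamma^* with T = Theta - M(0), where gamma is the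
   gamma-field at 0 (Krein's formula as an identity of linear relations). The condition
   inf sigma_ess > a is equivalent to a form bound (Tf,f) >= b|f|^2 - sum_{i<=n} (f,phi_i)^2 with
   b > a. Such bounds pass from A_Theta to T because the Friedrichs property allows every
   h in dom T to be lifted to elements A_0^{-1} g + gamma h of dom A_Theta with (A_0^{-1} g, g)
   arbitrarily small. In the other direction, approximate eigenvectors of A_Theta at a point
   lambda <= 0 of its essential spectrum have boundary data violating the form bound for T.
   The spectral theorem is avoided: only resolvents of self-adjoint relations for the real inner
   product are used. *)
theory Submission
  imports Defs
begin

section \<open>Hilbert space preliminaries\<close>

text \<open>The two directions are asymmetric because finite-rank functionals are. A functional of f
  restricted to f = \<gamma> h becomes one of h through the adjoint of \<gamma>. Conversely h
  \<bullet> \<phi> = \<gamma> h \<bullet> \<psi> with \<gamma> h = f - B g, where B is the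
  Friedrichs inverse, and B g is in general not controlled by f; so a form bound for T gives none
  for the extension directly. On approximate eigenvectors g is l f plus a small error, and the
  functional turns into one of f that can be made small. Since h and \<gamma> h are comparable only
  up to constants, thresholds get rescaled in both directions and only the value 0 survives; hence
  the separate estimates according to the sign of b. Form bounds detect the bottom of the essential
  spectrum once some bound exists. Lower semiboundedness supplies it for the extension, and the
  lifting carries it over to T.\<close>

lemma norm_diff_scaleR_square:
  fixes y v :: "'a::real_inner"
  shows "(norm (y - t *\<^sub>R v))\<^sup>2 = (norm y)\<^sup>2 - 2 * t * (y \<bullet> v) + t * t * (v \<bullet> v)"
  by (simp add: power2_norm_eq_inner inner_diff_left inner_diff_right inner_commute algebra_simps)

lemma hilbert_projection:
  fixes V :: "'a::{real_inner, complete_space} set"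
  assumes V: "subspace V" and cl: "closed V"
  obtains p where "p \<in> V" "\<And>v. v \<in> V \<Longrightarrow> (x - p) \<bullet> v = 0"
proof -
  define d where "d = (INF v\<in>V. norm (x - v))"
  have ne: "V \<noteq> {}" using V subspace_0 by blast
  have bdd: "bdd_below ((\<lambda>v. norm (x - v)) ` V)" by (rule bdd_belowI[of _ 0]) auto
  have low: "d \<le> norm (x - v)" if "v \<in> V" for v
    unfolding d_def by (rule cINF_lower[OF bdd that])
  have d0: "0 \<le> d" unfolding d_def by (rule cINF_greatest[OF ne]) auto
  have "\<exists>v\<in>V. norm (x - v) < d + 1 / real (Suc n)" for n
    using cInf_lessD[of "(\<lambda>v. norm (x - v)) ` V" "d + 1 / real (Suc n)"] ne
    unfolding d_def by auto
  then obtain w where w: "\<And>n. w n \<in> V" "\<And>n. norm (x - w n) < d + 1 / real (Suc n)" by metis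
  \<comment> \<open>Parallelogram law; the midpoint of \<open>w n\<close> and \<open>w m\<close>
    lies in V, hence has distance at least d from x.\<close>
  have par: "(norm (w n - w m))\<^sup>2 \<le> 2 * (norm (x - w n))\<^sup>2 + 2 * (norm (x - w m))\<^sup>2 - 4 * d\<^sup>2" for n m
  proof -
    have "(1/2) *\<^sub>R (w n + w m) \<in> V" using w(1) V by (simp add: subspace_add subspace_scale)
    from low[OF this] have "d\<^sup>2 \<le> (norm (x - (1/2) *\<^sub>R (w n + w m)))\<^sup>2"
      using d0 power_mono by blast
    then show ?thesis
      by (simp add: power2_norm_eq_inner algebra_simps inner_commute)
  qed
  have "(\<lambda>n. norm (x - w n)) \<longlonglongrightarrow> d"
  proof (rule tendsto_sandwich)
    show "(\<lambda>n. d) \<longlonglongrightarrow> d" by simp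
    show "(\<lambda>n. d + 1 / real (Suc n)) \<longlonglongrightarrow> d"
      using tendsto_add[OF tendsto_const LIMSEQ_inverse_real_of_nat, of d] by (simp add: inverse_eq_divide)
    show "\<forall>\<^sub>F n in sequentially. d \<le> norm (x - w n)" using low w by auto
    show "\<forall>\<^sub>F n in sequentially. norm (x - w n) \<le> d + 1 / real (Suc n)" by (intro always_eventually allI less_imp_le w(2))
  qed
  then have lim2: "(\<lambda>n. (norm (x - w n))\<^sup>2) \<longlonglongrightarrow> d\<^sup>2" by (intro tendsto_intros)
  have "Cauchy w"
  proof (rule metric_CauchyI)
    fix e :: real assume "e > 0"
    then have "eventually (\<lambda>n. (norm (x - w n))\<^sup>2 < d\<^sup>2 + e\<^sup>2/4) sequentially"
      by (intro order_tendstoD[OF lim2]) auto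
    then obtain N where N: "\<And>n. n \<ge> N \<Longrightarrow> (norm (x - w n))\<^sup>2 < d\<^sup>2 + e\<^sup>2/4"
      by (auto simp: eventually_sequentially)
    have "dist (w m) (w n) < e" if "m \<ge> N" "n \<ge> N" for m n
    proof -
      have "(norm (w m - w n))\<^sup>2 < e\<^sup>2" using par[of m n] N[OF that(1)] N[OF that(2)] by linarith
      then show ?thesis using \<open>e > 0\<close> by (simp add: dist_norm power_less_imp_less_base)
    qed
    then show "\<exists>M. \<forall>m\<ge>M. \<forall>n\<ge>M. dist (w m) (w n) < e" by blast
  qed
  then obtain p where p: "w \<longlonglongrightarrow> p" using Cauchy_convergent_iff convergent_def by blast
  have pV: "p \<in> V" using cl p w(1) closed_sequentially by blast
  have pd: "norm (x - p) = d"
    using LIMSEQ_unique[OF tendsto_norm[OF tendsto_diff[OF tendsto_const p]] \<open>(\<lambda>n. norm (x - w n)) \<longlonglongrightarrow> d\<close>] .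
  have "(x - p) \<bullet> v = 0" if v: "v \<in> V" for v
  proof (cases "v = 0")
    case False
    \<comment> \<open>Minimizer of the quadratic
      \<open>(norm (x - p - t *\<^sub>R v))\<^sup>2\<close> in t; since p is already closest, moving
      by it cannot gain anything.\<close>
    define t where "t = ((x - p) \<bullet> v) / (v \<bullet> v)"
    have "p + t *\<^sub>R v \<in> V" using pV v V by (simp add: subspace_add subspace_scale)
    from low[OF this] have "(norm (x - p))\<^sup>2 \<le> (norm ((x - p) - t *\<^sub>R v))\<^sup>2"
      using d0 power_mono pd by (metis diff_diff_add)
    also have "\<dots> = (norm (x - p))\<^sup>2 - 2 * t * ((x - p) \<bullet> v) + t * t * (v \<bullet> v)"
      by (rule norm_diff_scaleR_square)
    also have "t * t * (v \<bullet> v) = t * ((x - p) \<bullet> v)" using False by (simp add: t_def)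
    finally have "t * ((x - p) \<bullet> v) \<le> 0" by linarith
    moreover have "v \<bullet> v > 0" using False by simp
    ultimately have "((x - p) \<bullet> v)\<^sup>2 \<le> 0"
      by (simp add: t_def power2_eq_square divide_le_0_iff)
    then show ?thesis by simp
  qed simp
  with pV show ?thesis using that by blast
qed

lemma subspace_closure:
  fixes V :: "'a::real_normed_vector set"
  assumes V: "subspace V"
  shows "subspace (closure V)"
  unfolding subspace_def
proof (intro conjI ballI allI)
  show "0 \<in> closure V" using V closure_subset subspace_0 by blast
next
  fix x y assume "x \<in> closure V" "y \<in> closure V"
  then obtain f g where "\<And>n. f n \<in> V" "f \<longlonglongrightarrow> x" "\<And>n. g n \<in> V" "g \<longlonglongrightarrow> y"
    by (metis closure_sequential)
  then have "\<forall>n. f n + g n \<in> V" "(\<lambda>n. f n + g n) \<longlonglongrightarrow> x + y"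
    by (auto intro!: tendsto_intros subspace_add[OF V])
  then show "x + y \<in> closure V"
    unfolding closure_sequential by (intro exI[of _ "\<lambda>n. f n + g n"]) auto
next
  fix c :: real and x assume "x \<in> closure V"
  then obtain f where "\<And>n. f n \<in> V" "f \<longlonglongrightarrow> x"
    by (metis closure_sequential)
  then have "\<forall>n. c *\<^sub>R f n \<in> V" "(\<lambda>n. c *\<^sub>R f n) \<longlonglongrightarrow> c *\<^sub>R x"
    by (auto intro!: tendsto_intros subspace_scale[OF V])
  then show "c *\<^sub>R x \<in> closure V"
    unfolding closure_sequential by (intro exI[of _ "\<lambda>n. c *\<^sub>R f n"]) auto
qed

text \<open>Double orthogonal complement. W may be any set containing the complement of V, so that
  callers choose a convenient one: {0} for a dense range, the kernel for a symmetric
  operator.\<close>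

lemma mem_closure_if_orthogonal:
  fixes V :: "'a::{real_inner, complete_space} set"
  assumes V: "subspace V" and "\<And>x. (\<And>v. v \<in> V \<Longrightarrow> x \<bullet> v = 0) \<Longrightarrow> x \<in> W" "\<And>w. w \<in> W \<Longrightarrow> x \<bullet> w = 0"
  shows "x \<in> closure V"
proof -
  have sub: "subspace (closure V)" by (rule subspace_closure[OF V])
  obtain p where p: "p \<in> closure V" "\<And>v. v \<in> closure V \<Longrightarrow> (x - p) \<bullet> v = 0"
    using hilbert_projection[OF sub closed_closure] by metis
  have W: "x - p \<in> W" using p(2) closure_subset assms(2) by (metis subsetD)
  then have "x \<bullet> (x - p) = 0" using assms(3) by blast
  moreover have "(x - p) \<bullet> p = 0" using p by blast
  ultimately have "(x - p) \<bullet> (x - p) = 0" by (simp add: inner_diff_left inner_diff_right inner_commute)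
  then show ?thesis using p by simp
qed

text \<open>Uniform boundedness principle by Baire category: the closed sets \<open>A n\<close>
  cover the space, so one of them contains a ball.\<close>

lemma weakly_bounded_imp_bounded:
  fixes \<Phi> :: "'a::{real_inner, complete_space} set"
  assumes "\<And>g. \<exists>C. \<forall>\<phi>\<in>\<Phi>. \<bar>\<phi> \<bullet> g\<bar> \<le> C"
  obtains C where "C > 0" "\<And>\<phi>. \<phi> \<in> \<Phi> \<Longrightarrow> norm \<phi> \<le> C"
proof -
  define A where "A n = {g. \<forall>\<phi>\<in>\<Phi>. \<bar>\<phi> \<bullet> g\<bar> \<le> real n}" for n
  have cl: "closed (A n)" for n
  proof -
    have "A n = (\<Inter>\<phi>\<in>\<Phi>. {g. \<bar>\<phi> \<bullet> g\<bar> \<le> real n})" by (auto simp: A_def)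
    then show ?thesis by (auto intro!: closed_INT closed_Collect_le continuous_intros)
  qed
  have "\<Union>(range A) = UNIV"
  proof -
    have "g \<in> \<Union>(range A)" for g
    proof -
      obtain C where C: "\<forall>\<phi>\<in>\<Phi>. \<bar>\<phi> \<bullet> g\<bar> \<le> C" using assms by blast
      obtain n where "C \<le> real n" using real_arch_simple by blast
      with C have "g \<in> A n" unfolding A_def by (auto intro: order_trans)
      then show ?thesis by blast
    qed
    then show ?thesis by blast
  qed
  have "\<exists>n. interior (A n) \<noteq> {}"
  proof (rule ccontr)
    assume empty: "\<not> (\<exists>n. interior (A n) \<noteq> {})"
    have "interior (\<Union>(range A)) = {}"
    proof -
      have "Met_TC.mcomplete TYPE('a)" by (simp add: complete_UNIV)
      then have "Met_TC.mtopology interior_of \<Union>(range A) = {}"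
      proof (rule Met_TC.metric_Baire_category_alt)
        show "countable (range A)" by simp
        show "closedin Met_TC.mtopology T \<and> Met_TC.mtopology interior_of T = {}"
          if T: "T \<in> range A" for T
        proof -
          obtain n where n: "T = A n" using T by blast
          have "interior (A n) = {}" using empty by blast
          then show ?thesis unfolding n using cl[of n] by simp
        qed
      qed
      then show ?thesis by simp
    qed
    with \<open>\<Union>(range A) = UNIV\<close> show False by simp
  qed
  then obtain n x r where r: "r > 0" "ball x r \<subseteq> A n"
    by (metis equals0I mem_interior)
  \<comment> \<open>Both x and its shift by r/2 in the direction of \<phi> lie in the ball, so r/2
    times the norm is at most 2n. The summand 1 keeps the constant positive when n = 0.\<close>
  have "norm \<phi> \<le> 4 * real n / r + 1" if "\<phi> \<in> \<Phi>" for \<phi>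
  proof (cases "\<phi> = 0")
    case False
    define y where "y = x + (r / 2 / norm \<phi>) *\<^sub>R \<phi>"
    have "y \<in> ball x r" using r False by (simp add: y_def dist_norm)
    then have "y \<in> A n" using r(2) by blast
    then have 1: "\<bar>\<phi> \<bullet> y\<bar> \<le> real n" using that by (simp add: A_def)
    have "x \<in> ball x r" using r by simp
    then have "x \<in> A n" using r(2) by blast
    then have 2: "\<bar>\<phi> \<bullet> x\<bar> \<le> real n" using that by (simp add: A_def)
    have "\<phi> \<bullet> y = \<phi> \<bullet> x + r / 2 * norm \<phi>"
      using False by (simp add: y_def inner_add_right dot_square_norm power2_eq_square)
    then have "r / 2 * norm \<phi> \<le> 2 * real n" using 1 2 by linarith
    then show ?thesis using r by (simp add: field_simps)
  qed (use r in simp)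
  moreover have "4 * real n / r + 1 > 0" using r by (simp add: add_nonneg_pos)
  ultimately show ?thesis using that by blast
qed

section \<open>Finite-rank quadratic forms\<close>

text \<open>Nonnegative quadratic forms of finite rank. Lists let concatenation add forms, and
  mapping a non-injective function over the vectors does no harm.\<close>

definition list_form :: "'a::real_inner list \<Rightarrow> 'a \<Rightarrow> real" where
  "list_form L f = (\<Sum>\<phi>\<leftarrow>L. (f \<bullet> \<phi>)\<^sup>2)"

lemma list_form_Nil [simp]: "list_form [] f = 0"
  and list_form_Cons [simp]: "list_form (\<phi> # L) f = (f \<bullet> \<phi>)\<^sup>2 + list_form L f"
  and list_form_append [simp]: "list_form (L @ L') f = list_form L f + list_form L' f"
  by (simp_all add: list_form_def)

lemma list_form_nonneg [simp]: "0 \<le> list_form L f"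
  by (induction L) auto

lemma list_form_scaleR: "list_form L (c *\<^sub>R f) = c\<^sup>2 * list_form L f"
  by (induction L) (auto simp: power_mult_distrib algebra_simps)

lemma list_form_map_scaleR: "list_form (map (scaleR c) L) f = c\<^sup>2 * list_form L f"
  by (induction L) (auto simp: power_mult_distrib algebra_simps)

text \<open>Pulls functionals back along an adjoint: \<psi> will be the adjoint of \<gamma>, a
  projection, or 1 - \<epsilon> X.\<close>

lemma list_form_map_eq:
  "(\<And>\<phi>. \<phi> \<in> set L \<Longrightarrow> f \<bullet> \<phi> = f' \<bullet> \<psi> \<phi>) \<Longrightarrow> list_form L f = list_form (map \<psi> L) f'"
  by (induction L) auto

lemma square_diff_le: "(a - b)\<^sup>2 \<le> 2 * a\<^sup>2 + 2 * (b::real)\<^sup>2"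
  using zero_le_power2[of "a + b"] by (simp add: power2_eq_square algebra_simps)

lemma norm_diff_square_le: "(norm (a - b))\<^sup>2 \<le> 2 * (norm a)\<^sup>2 + 2 * (norm (b::'a::real_inner))\<^sup>2"
  using inner_ge_zero[of "a + b"]
  by (simp add: power2_norm_eq_inner inner_add_left inner_add_right inner_diff_left inner_diff_right inner_commute)

lemma list_form_diff_le: "list_form L (f - g) \<le> 2 * list_form L f + 2 * list_form L g"
proof (induction L)
  case (Cons \<phi> L)
  then show ?case using square_diff_le[of "f \<bullet> \<phi>" "g \<bullet> \<phi>"] by (simp add: inner_diff_left)
qed simp

lemma tendsto_list_form: "(u \<longlongrightarrow> f) F \<Longrightarrow> ((\<lambda>n. list_form L (u n)) \<longlongrightarrow> list_form L f) F"
  by (induction L) (auto intro!: tendsto_intros)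

lemma finite_dim_norm_list_form:
  fixes B :: "'a::real_inner set"
  assumes "finite B"
  obtains L where "set L \<subseteq> span B" "\<And>e. e \<in> span B \<Longrightarrow> (norm e)\<^sup>2 = list_form L e"
proof -
  obtain C where C: "finite C" "span C = span B" "pairwise orthogonal C"
    using basis_orthogonal[OF assms] by blast
  obtain cs where cs: "set cs = C" "distinct cs" using finite_distinct_list[OF C(1)] by blast
  \<comment> \<open>A zero vector in C, if present, is sent to 0 by the normalisation and
    contributes nothing to either side.\<close>
  define L where "L = map (\<lambda>c. c /\<^sub>R norm c) cs"
  have "set L \<subseteq> span B"
    using cs(1) span_base[of _ C] unfolding L_def C(2) by (auto intro!: span_scale)
  moreover have "(norm e)\<^sup>2 = list_form L e" if eB: "e \<in> span B" for e
  proof -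
    obtain a where a: "e = (\<Sum>c\<in>C. a c *\<^sub>R c)"
      using eB span_finite[OF C(1)] unfolding C(2)[symmetric] by auto
    have ec: "e \<bullet> c = a c * (norm c)\<^sup>2" if "c \<in> C" for c
    proof -
      have "e \<bullet> c = (\<Sum>d\<in>C. a d * (d \<bullet> c))" by (simp add: a inner_sum_left)
      also have "\<dots> = (\<Sum>d\<in>C. if d = c then a c * (norm c)\<^sup>2 else 0)"
        using C(3) that by (intro sum.cong) (auto simp: pairwise_def orthogonal_def power2_norm_eq_inner)
      finally show ?thesis using C(1) that by simp
    qed
    have "list_form L e = (\<Sum>c\<in>C. (e \<bullet> (c /\<^sub>R norm c))\<^sup>2)"
      using cs by (simp add: list_form_def L_def sum_list_distinct_conv_sum_set o_def)
    also have "\<dots> = (\<Sum>c\<in>C. a c * (e \<bullet> c))"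
      by (intro sum.cong refl) (simp add: ec power2_eq_square field_simps)
    also have "\<dots> = e \<bullet> (\<Sum>c\<in>C. a c *\<^sub>R c)" by (simp add: inner_sum_right)
    finally show ?thesis by (simp add: a[symmetric] power2_norm_eq_inner)
  qed
  ultimately show ?thesis using that by blast
qed

text \<open>Each functional lowers the dimension by at most one: E is spanned by the part where
  \<phi> vanishes and a single e with e \<bullet> \<phi> \<noteq> 0.\<close>

lemma finite_dim_if_separated_by_list:
  fixes E :: "'a::real_inner set"
  assumes "subspace E" "\<And>f. f \<in> E \<Longrightarrow> (\<And>\<phi>. \<phi> \<in> set L \<Longrightarrow> f \<bullet> \<phi> = 0) \<Longrightarrow> f = 0"
  obtains B where "finite B" "E \<subseteq> span B"
  using assms
proof (induction L arbitrary: E thesis)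
  case Nil
  then have "E \<subseteq> {0}" by auto
  then show ?case using Nil.prems(1)[of "{}"] by simp
next
  case (Cons \<phi> L)
  define E' where "E' = {f \<in> E. f \<bullet> \<phi> = 0}"
  have "subspace E'" using Cons.prems(2)
    by (auto simp: E'_def subspace_def inner_add_left)
  moreover have "f = 0" if "f \<in> E'" "\<And>\<phi>. \<phi> \<in> set L \<Longrightarrow> f \<bullet> \<phi> = 0" for f
    using Cons.prems(3)[of f] that by (auto simp: E'_def)
  ultimately obtain B where B: "finite B" "E' \<subseteq> span B" using Cons.IH by blast
  show ?case
  proof (cases "E = E'")
    case False
    then obtain e where e: "e \<in> E" "e \<bullet> \<phi> \<noteq> 0" by (auto simp: E'_def)
    have "f \<in> span (insert e B)" if "f \<in> E" for f
    proof -
      have "f - ((f \<bullet> \<phi>) / (e \<bullet> \<phi>)) *\<^sub>R e \<in> E'"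
        using that e Cons.prems(2) by (auto simp: E'_def inner_diff_left subspace_diff subspace_scale)
      then show ?thesis using B(2) span_breakdown_eq by blast
    qed
    then show ?thesis using Cons.prems(1)[of "insert e B"] B(1) by blast
  qed (use B Cons.prems(1) in blast)
qed

section \<open>Self-adjoint relations and their resolvents\<close>

text \<open>Equality with the adjoint for the real inner product is the only axiom: an adjoint is
  automatically a closed linear subspace, which yields the algebraic and limit rules below.\<close>

locale sa_relation =
  fixes T :: "('a::{real_inner, complete_space} \<times> 'a) set"
  assumes mem_iff: "(a, b) \<in> T \<longleftrightarrow> (\<forall>f g. (f, g) \<in> T \<longrightarrow> g \<bullet> a = f \<bullet> b)"
begin

lemma symm: "(f, g) \<in> T \<Longrightarrow> (a, b) \<in> T \<Longrightarrow> g \<bullet> a = f \<bullet> b"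
  using mem_iff by blast

lemma zero_mem: "(0, 0) \<in> T"
  by (subst mem_iff) simp

lemma add_mem: "(f, g) \<in> T \<Longrightarrow> (f', g') \<in> T \<Longrightarrow> (f + f', g + g') \<in> T"
  unfolding mem_iff[of "f + f'"] by (simp add: inner_add_right symm)

lemma scale_mem: "(f, g) \<in> T \<Longrightarrow> (c *\<^sub>R f, c *\<^sub>R g) \<in> T"
  unfolding mem_iff[of "c *\<^sub>R f"] by (simp add: symm)

lemma diff_mem: "(f, g) \<in> T \<Longrightarrow> (f', g') \<in> T \<Longrightarrow> (f - f', g - g') \<in> T"
  using add_mem[OF _ scale_mem[of f' g' "-1"]] by simp

lemma lim_mem:
  assumes "\<And>n. (u n, v n) \<in> T" "u \<longlonglongrightarrow> f" "v \<longlonglongrightarrow> g"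
  shows "(f, g) \<in> T"
  unfolding mem_iff[of f]
proof (intro allI impI)
  fix a b assume ab: "(a, b) \<in> T"
  have "(\<lambda>n. b \<bullet> u n) \<longlonglongrightarrow> b \<bullet> f" "(\<lambda>n. a \<bullet> v n) \<longlonglongrightarrow> a \<bullet> g"
    using assms by (auto intro!: tendsto_intros)
  moreover have "b \<bullet> u n = a \<bullet> v n" for n using symm[OF ab assms(1)] .
  ultimately show "b \<bullet> f = a \<bullet> g" using LIMSEQ_unique by auto
qed

lemma subspace_rdom: "subspace (rdom T)"
  unfolding subspace_def
proof (intro conjI ballI allI)
  show "0 \<in> rdom T" using zero_mem by (force simp: rdom_def)
next
  fix x y assume "x \<in> rdom T" "y \<in> rdom T"
  then obtain x' y' where "(x, x') \<in> T" "(y, y') \<in> T" by (auto simp: rdom_def)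
  from add_mem[OF this] show "x + y \<in> rdom T" by (force simp: rdom_def)
next
  fix c :: real and x assume "x \<in> rdom T"
  then obtain x' where "(x, x') \<in> T" by (auto simp: rdom_def)
  from scale_mem[OF this, of c] show "c *\<^sub>R x \<in> rdom T" by (force simp: rdom_def)
qed

lemma closure_rdom_orth: "h \<in> closure (rdom T) \<Longrightarrow> (0, m) \<in> T \<Longrightarrow> h \<bullet> m = 0"
proof -
  assume "h \<in> closure (rdom T)" and m: "(0, m) \<in> T"
  then obtain u where u: "\<And>n. u n \<in> rdom T" "u \<longlonglongrightarrow> h" by (metis closure_sequential)
  have "u n \<bullet> m = 0" for n
  proof -
    obtain g where "(u n, g) \<in> T" using u(1)[of n] by (auto simp: rdom_def)
    from symm[OF this m] show ?thesis by simp
  qed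
  moreover have "(\<lambda>n. u n \<bullet> m) \<longlonglongrightarrow> h \<bullet> m" using u(2) by (intro tendsto_intros)
  ultimately show ?thesis using LIMSEQ_unique[of "\<lambda>n. 0::real"] by simp
qed

text \<open>A pair with first entry 0 lies in the adjoint as soon as its second entry is orthogonal
  to the domain, so the component of g off the closed domain belongs to the multivalued
  part.\<close>

lemma op_part_decomp:
  assumes "(f, g) \<in> T"
  obtains g0 m where "(f, g0) \<in> op_part T" "(0, m) \<in> T" "g = g0 + m"
proof -
  obtain g0 where g0: "g0 \<in> closure (rdom T)" "\<And>v. v \<in> closure (rdom T) \<Longrightarrow> (g - g0) \<bullet> v = 0"
    using hilbert_projection[OF subspace_closure[OF subspace_rdom] closed_closure] by metis
  have m: "(0, g - g0) \<in> T"
    unfolding mem_iff[of 0]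
  proof (intro allI impI)
    fix a b assume "(a, b) \<in> T"
    then have "a \<in> rdom T" by (force simp: rdom_def)
    then have "a \<in> closure (rdom T)" using closure_subset by blast
    then show "b \<bullet> 0 = a \<bullet> (g - g0)" using g0(2)[of a] by (simp add: inner_commute)
  qed
  have "(f, g0) \<in> op_part T"
    using diff_mem[OF assms m] g0(1) by (simp add: op_part_def)
  then show ?thesis using that m by simp
qed

text \<open>The resolvent set expressed by a lower bound alone: surjectivity follows from
  self-adjointness, and the bound may be tested on T or on its operator part, because the
  multivalued part is orthogonal.\<close>

definition regular_at :: "real \<Rightarrow> bool" where
  "regular_at \<mu> \<longleftrightarrow> (\<exists>c>0. \<forall>f g. (f, g) \<in> T \<longrightarrow> c * norm f \<le> norm (g - \<mu> *\<^sub>R f))"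

text \<open>A vector x orthogonal to the range of T - \<mu> gives the pair (x, \<mu> x) in T, which
  regularity forces to be zero, so the range is dense. The lower bound makes preimages of a
  convergent sequence Cauchy, and T is closed.\<close>

lemma surj_if_regular:
  assumes "regular_at \<mu>"
  obtains f where "(f, h + \<mu> *\<^sub>R f) \<in> T"
proof -
  obtain c where c: "c > 0" "\<And>f g. (f, g) \<in> T \<Longrightarrow> c * norm f \<le> norm (g - \<mu> *\<^sub>R f)"
    using assms unfolding regular_at_def by blast
  define V where "V = (\<lambda>(f, g). g - \<mu> *\<^sub>R f) ` T"
  have V: "subspace V"
    unfolding subspace_def
  proof (intro conjI ballI allI)
    show "0 \<in> V" using zero_mem by (force simp: V_def)
  next
    fix x y assume "x \<in> V" "y \<in> V"
    then obtain f g f' g' where fg: "(f, g) \<in> T" "(f', g') \<in> T" and xy: "x = g - \<mu> *\<^sub>R f" "y = g' - \<mu> *\<^sub>R f'"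
      by (auto simp: V_def)
    have "x + y = (g + g') - \<mu> *\<^sub>R (f + f')" by (simp add: xy algebra_simps)
    then show "x + y \<in> V" using add_mem[OF fg] by (force simp: V_def)
  next
    fix x and r :: real assume "x \<in> V"
    then obtain f g where fg: "(f, g) \<in> T" and x: "x = g - \<mu> *\<^sub>R f" by (auto simp: V_def)
    have "r *\<^sub>R x = (r *\<^sub>R g) - \<mu> *\<^sub>R (r *\<^sub>R f)" by (simp add: x algebra_simps)
    then show "r *\<^sub>R x \<in> V" using scale_mem[OF fg] by (force simp: V_def)
  qed
  have "h \<in> closure V"
  proof (rule mem_closure_if_orthogonal[OF V])
    show "x \<in> {0}" if "\<And>v. v \<in> V \<Longrightarrow> x \<bullet> v = 0" for x
    proof -
      have "g \<bullet> x = f \<bullet> (\<mu> *\<^sub>R x)" if fg: "(f, g) \<in> T" for f g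
      proof -
        have "g - \<mu> *\<^sub>R f \<in> V" using fg by (force simp: V_def)
        from \<open>\<And>v. v \<in> V \<Longrightarrow> x \<bullet> v = 0\<close>[OF this] show ?thesis
          by (simp add: inner_diff_right inner_commute)
      qed
      then have "(x, \<mu> *\<^sub>R x) \<in> T" unfolding mem_iff[of x] by blast
      from c(2)[OF this] c(1) show ?thesis by (simp add: mult_le_0_iff)
    qed
  qed simp
  then obtain v where v: "\<And>n. v n \<in> V" "v \<longlonglongrightarrow> h" by (metis closure_sequential)
  then have "\<exists>f g. (f, g) \<in> T \<and> v n = g - \<mu> *\<^sub>R f" for n by (force simp: V_def)
  then obtain u w where uw: "\<And>n. (u n, w n) \<in> T" "\<And>n. v n = w n - \<mu> *\<^sub>R u n" by metis
  have "Cauchy u"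
  proof (rule metric_CauchyI)
    fix e :: real assume "e > 0"
    then obtain N where N: "\<And>m n. m \<ge> N \<Longrightarrow> n \<ge> N \<Longrightarrow> dist (v m) (v n) < c * e"
      using metric_CauchyD[OF LIMSEQ_imp_Cauchy[OF v(2)], of "c * e"] c(1) by auto
    have "dist (u m) (u n) < e" if "m \<ge> N" "n \<ge> N" for m n
    proof -
      have "c * norm (u m - u n) \<le> norm (w m - w n - \<mu> *\<^sub>R (u m - u n))"
        using c(2)[OF diff_mem[OF uw(1) uw(1)]] .
      also have "\<dots> = dist (v m) (v n)" by (simp add: dist_norm uw(2) algebra_simps)
      also have "\<dots> < c * e" using N that by blast
      finally show ?thesis using c(1) by (simp add: dist_norm)
    qed
    then show "\<exists>M. \<forall>m\<ge>M. \<forall>n\<ge>M. dist (u m) (u n) < e" by blast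
  qed
  then obtain f where f: "u \<longlonglongrightarrow> f" using Cauchy_convergent_iff convergent_def by blast
  have "(\<lambda>n. v n + \<mu> *\<^sub>R u n) \<longlonglongrightarrow> h + \<mu> *\<^sub>R f" using v(2) f by (intro tendsto_intros)
  then have "w \<longlonglongrightarrow> h + \<mu> *\<^sub>R f" by (simp add: uw(2))
  then have "(f, h + \<mu> *\<^sub>R f) \<in> T" using lim_mem[OF uw(1) f] by blast
  then show ?thesis using that by blast
qed

lemma not_in_spectrum_iff: "\<mu> \<notin> sa_spectrum T \<longleftrightarrow> regular_at \<mu>"
proof
  assume "\<mu> \<notin> sa_spectrum T"
  then obtain C where C: "\<And>f g. (f, g) \<in> op_part T \<Longrightarrow> norm f \<le> C * norm (g - \<mu> *\<^sub>R f)"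
    unfolding sa_spectrum_def by blast
  \<comment> \<open>C carries no sign, so \<open>\<bar>C\<bar> + 1\<close> serves as a positive
    substitute.\<close>
  have "1 / (\<bar>C\<bar> + 1) * norm f \<le> norm (g - \<mu> *\<^sub>R f)" if fg: "(f, g) \<in> T" for f g
  proof -
    obtain g0 m where g0: "(f, g0) \<in> op_part T" "(0, m) \<in> T" "g = g0 + m"
      using op_part_decomp[OF fg] by metis
    have "f \<in> closure (rdom T)" using fg closure_subset by (force simp: rdom_def)
    then have "g0 - \<mu> *\<^sub>R f \<in> closure (rdom T)" using g0(1)
      subspace_diff[OF subspace_closure[OF subspace_rdom]] subspace_scale[OF subspace_closure[OF subspace_rdom]]
      by (auto simp: op_part_def)
    then have orth: "(g0 - \<mu> *\<^sub>R f) \<bullet> m = 0" using closure_rdom_orth g0(2) by blast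
    have split: "g - \<mu> *\<^sub>R f = (g0 - \<mu> *\<^sub>R f) + m" by (simp add: g0(3))
    \<comment> \<open>Dropping the orthogonal multivalued component m can only shorten the
      vector.\<close>
    have "(norm (g0 - \<mu> *\<^sub>R f))\<^sup>2 \<le> (norm (g - \<mu> *\<^sub>R f))\<^sup>2"
      unfolding split using orth by (subst norm_add_Pythagorean) (simp_all add: orthogonal_def)
    then have "norm (g0 - \<mu> *\<^sub>R f) \<le> norm (g - \<mu> *\<^sub>R f)" by (rule power2_le_imp_le) simp
    then have "norm f \<le> (\<bar>C\<bar> + 1) * norm (g - \<mu> *\<^sub>R f)"
      using C[OF g0(1)] by (smt (verit) mult_mono norm_ge_zero)
    then show ?thesis by (simp add: field_simps)
  qed
  moreover have "1 / (\<bar>C\<bar> + 1) > 0" by (simp add: add_nonneg_pos)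
  ultimately show "regular_at \<mu>" unfolding regular_at_def by blast
next
  assume reg: "regular_at \<mu>"
  then obtain c where c: "c > 0" "\<And>f g. (f, g) \<in> T \<Longrightarrow> c * norm f \<le> norm (g - \<mu> *\<^sub>R f)"
    unfolding regular_at_def by blast
  have "\<exists>f. (f, h + \<mu> *\<^sub>R f) \<in> op_part T" if h: "h \<in> closure (rdom T)" for h
  proof -
    obtain f where f: "(f, h + \<mu> *\<^sub>R f) \<in> T" using surj_if_regular[OF reg] .
    then have "f \<in> closure (rdom T)" using closure_subset by (force simp: rdom_def)
    then have "h + \<mu> *\<^sub>R f \<in> closure (rdom T)"
      using h subspace_add[OF subspace_closure[OF subspace_rdom]] subspace_scale[OF subspace_closure[OF subspace_rdom]]
      by blast
    with f show ?thesis by (auto simp: op_part_def)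
  qed
  moreover have "norm f \<le> (1 / c) * norm (g - \<mu> *\<^sub>R f)" if "(f, g) \<in> op_part T" for f g
    using c that by (auto simp: op_part_def field_simps)
  ultimately show "\<mu> \<notin> sa_spectrum T" unfolding sa_spectrum_def by blast
qed

section \<open>Eigenspaces and lower bounds modulo finitely many functionals\<close>

lemma eigenspace_rel_iff: "f \<in> eigenspace_rel T l \<longleftrightarrow> (f, l *\<^sub>R f) \<in> T"
proof
  assume fT: "(f, l *\<^sub>R f) \<in> T"
  then have "f \<in> closure (rdom T)" using closure_subset by (force simp: rdom_def)
  then have "l *\<^sub>R f \<in> closure (rdom T)"
    using subspace_scale[OF subspace_closure[OF subspace_rdom]] by blast
  with fT show "f \<in> eigenspace_rel T l" by (simp add: eigenspace_rel_def op_part_def)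
qed (simp add: eigenspace_rel_def op_part_def)

lemma subspace_eigenspace: "subspace (eigenspace_rel T l)"
  unfolding subspace_def eigenspace_rel_iff
proof (intro conjI ballI allI)
  show "(0, l *\<^sub>R 0) \<in> T" using zero_mem by simp
next
  fix x y assume "x \<in> eigenspace_rel T l" "y \<in> eigenspace_rel T l"
  then show "(x + y, l *\<^sub>R (x + y)) \<in> T"
    using add_mem by (simp add: eigenspace_rel_iff scaleR_add_right)
next
  fix c :: real and x assume "x \<in> eigenspace_rel T l"
  then have "(x, l *\<^sub>R x) \<in> T" by (simp add: eigenspace_rel_iff)
  from scale_mem[OF this, of c] show "(c *\<^sub>R x, l *\<^sub>R c *\<^sub>R x) \<in> T" by (simp add: mult.commute)
qed

lemma closed_eigenspace: "closed (eigenspace_rel T l)"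
  unfolding closed_sequential_limits eigenspace_rel_iff
proof (intro allI impI, elim conjE)
  fix x f assume x: "\<forall>n. (x n, l *\<^sub>R x n) \<in> T" "x \<longlonglongrightarrow> f"
  show "(f, l *\<^sub>R f) \<in> T"
    by (rule lim_mem[OF _ x(2) tendsto_scaleR[OF tendsto_const x(2)]]) (simp add: x(1))
qed

lemma eigenspace_orth:
  assumes "(f, g) \<in> T" "e \<in> eigenspace_rel T l"
  shows "g \<bullet> e = l * (f \<bullet> e)"
  using symm[OF assms(1)] assms(2) by (simp add: eigenspace_rel_iff)

lemma eigenspace_decomp:
  assumes "(f, g) \<in> T"
  obtains e f' where "e \<in> eigenspace_rel T l" "f = e + f'" "(f', g - l *\<^sub>R e) \<in> T"
    "\<And>x. x \<in> eigenspace_rel T l \<Longrightarrow> f' \<bullet> x = 0"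
proof -
  obtain e where e: "e \<in> eigenspace_rel T l" "\<And>x. x \<in> eigenspace_rel T l \<Longrightarrow> (f - e) \<bullet> x = 0"
    using hilbert_projection[OF subspace_eigenspace closed_eigenspace] by metis
  have "(f - e, g - l *\<^sub>R e) \<in> T" using diff_mem[OF assms] e(1) by (simp add: eigenspace_rel_iff)
  then show ?thesis using that[of e "f - e"] e by simp
qed

text \<open>If the bound failed without \<phi>, there would be approximate eigenvectors normalised
  by f \<bullet> \<phi> = 1. Their differences have vanishing \<phi>-coordinate, so the assumed
  bound makes them Cauchy. The limit is an eigenvector orthogonal to all eigenvectors, hence 0,
  contradicting the normalisation.\<close>

lemma drop_coordinate:
  assumes "\<epsilon> > 0" and bound: "\<And>f g. (f, g) \<in> T \<Longrightarrow> (\<And>e. e \<in> eigenspace_rel T l \<Longrightarrow> f \<bullet> e = 0) \<Longrightarrow>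
      \<epsilon> * (norm f)\<^sup>2 \<le> (norm (g - l *\<^sub>R f))\<^sup>2 + list_form (\<phi> # L) f"
  shows "\<exists>\<epsilon>'>0. \<forall>f g. (f, g) \<in> T \<longrightarrow> (\<forall>e\<in>eigenspace_rel T l. f \<bullet> e = 0) \<longrightarrow>
      \<epsilon>' * (norm f)\<^sup>2 \<le> (norm (g - l *\<^sub>R f))\<^sup>2 + list_form L f"
proof (rule ccontr)
  assume "\<not> ?thesis"
  then have neg: "\<exists>f g. (f, g) \<in> T \<and> (\<forall>e\<in>eigenspace_rel T l. f \<bullet> e = 0) \<and>
      (norm (g - l *\<^sub>R f))\<^sup>2 + list_form L f < \<kappa> * (norm f)\<^sup>2" if "\<kappa> > 0" for \<kappa>
    using that by (meson not_less)
  have "\<exists>f g. (f, g) \<in> T \<and> (\<forall>e\<in>eigenspace_rel T l. f \<bullet> e = 0) \<and> f \<bullet> \<phi> = 1 \<and>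
      (norm (g - l *\<^sub>R f))\<^sup>2 + list_form L f < \<eta>" if "\<eta> > 0" for \<eta>
  proof -
    \<comment> \<open>The first entry lets half of \<epsilon> be absorbed, so that (f \<bullet>
      \<phi>)^2 dominates \<epsilon>/2 times the squared norm; the second makes the residual smaller
      than \<eta> after rescaling to f \<bullet> \<phi> = 1.\<close>
    define \<kappa> where "\<kappa> = min (\<epsilon> / 2) (\<eta> * \<epsilon> / 2)"
    have "\<kappa> > 0" using assms(1) that by (simp add: \<kappa>_def)
    then obtain f g where fg: "(f, g) \<in> T" "\<And>e. e \<in> eigenspace_rel T l \<Longrightarrow> f \<bullet> e = 0"
      and less: "(norm (g - l *\<^sub>R f))\<^sup>2 + list_form L f < \<kappa> * (norm f)\<^sup>2"
      using neg by blast
    have "\<kappa> * (norm f)\<^sup>2 > 0" using less by (smt (verit) list_form_nonneg zero_le_power2)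
    then have nf: "(norm f)\<^sup>2 > 0" by (simp add: zero_less_mult_iff)
    have "\<epsilon> * (norm f)\<^sup>2 \<le> (norm (g - l *\<^sub>R f))\<^sup>2 + list_form (\<phi> # L) f" using bound fg by blast
    moreover have "\<kappa> * (norm f)\<^sup>2 \<le> \<epsilon> / 2 * (norm f)\<^sup>2"
      by (rule mult_right_mono) (auto simp: \<kappa>_def)
    ultimately have f\<phi>: "\<epsilon> / 2 * (norm f)\<^sup>2 \<le> (f \<bullet> \<phi>)\<^sup>2" using less by simp
    then have pos: "(f \<bullet> \<phi>)\<^sup>2 > 0" using nf assms(1) by (smt (verit) half_gt_zero mult_pos_pos)
    define t where "t = 1 / (f \<bullet> \<phi>)"
    have "(norm (t *\<^sub>R g - l *\<^sub>R t *\<^sub>R f))\<^sup>2 + list_form L (t *\<^sub>R f)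
        = t\<^sup>2 * ((norm (g - l *\<^sub>R f))\<^sup>2 + list_form L f)"
    proof -
      have "t *\<^sub>R g - l *\<^sub>R t *\<^sub>R f = t *\<^sub>R (g - l *\<^sub>R f)" by (simp add: algebra_simps)
      then show ?thesis by (simp add: list_form_scaleR power_mult_distrib distrib_left)
    qed
    also have "\<dots> < t\<^sup>2 * (\<kappa> * (norm f)\<^sup>2)" using less pos by (simp add: t_def)
    also have "\<dots> \<le> t\<^sup>2 * (\<eta> * (\<epsilon> / 2 * (norm f)\<^sup>2))"
    proof (intro mult_left_mono)
      have "\<kappa> \<le> \<eta> * (\<epsilon> / 2)" by (simp add: \<kappa>_def)
      then show "\<kappa> * (norm f)\<^sup>2 \<le> \<eta> * (\<epsilon> / 2 * (norm f)\<^sup>2)"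
        using mult_right_mono[of \<kappa> "\<eta> * (\<epsilon> / 2)" "(norm f)\<^sup>2"] by simp
    qed simp
    also have "\<dots> \<le> t\<^sup>2 * (\<eta> * (f \<bullet> \<phi>)\<^sup>2)"
      using f\<phi> that by (intro mult_left_mono) auto
    also have "\<dots> = \<eta>" using pos by (simp add: t_def power_divide)
    finally have "(norm (t *\<^sub>R g - l *\<^sub>R t *\<^sub>R f))\<^sup>2 + list_form L (t *\<^sub>R f) < \<eta>" .
    moreover have "(t *\<^sub>R f) \<bullet> \<phi> = 1" using pos by (simp add: t_def)
    ultimately show ?thesis using scale_mem[OF fg(1)] fg(2) by (metis inner_scaleR_left mult_zero_right)
  qed
  then have "\<exists>f g. (f, g) \<in> T \<and> (\<forall>e\<in>eigenspace_rel T l. f \<bullet> e = 0) \<and> f \<bullet> \<phi> = 1 \<and>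
      (norm (g - l *\<^sub>R f))\<^sup>2 + list_form L f < 1 / real (Suc n)" for n
    by simp
  then obtain u v where uv: "\<And>n. (u n, v n) \<in> T" "\<And>n e. e \<in> eigenspace_rel T l \<Longrightarrow> u n \<bullet> e = 0"
      "\<And>n. u n \<bullet> \<phi> = 1" "\<And>n. (norm (v n - l *\<^sub>R u n))\<^sup>2 + list_form L (u n) < 1 / real (Suc n)"
    by metis
  have est: "\<epsilon> * (norm (u m - u n))\<^sup>2 \<le> 2 / real (Suc m) + 2 / real (Suc n)" for m n
  proof -
    have "\<epsilon> * (norm (u m - u n))\<^sup>2
        \<le> (norm ((v m - v n) - l *\<^sub>R (u m - u n)))\<^sup>2 + list_form (\<phi> # L) (u m - u n)"
      using bound[OF diff_mem[OF uv(1) uv(1)]] uv(2) by (simp add: inner_diff_left)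
    moreover have "list_form (\<phi> # L) (u m - u n) \<le> 2 * list_form L (u m) + 2 * list_form L (u n)"
      using list_form_diff_le uv(3) by (simp add: inner_diff_left)
    moreover have "(v m - v n) - l *\<^sub>R (u m - u n) = (v m - l *\<^sub>R u m) - (v n - l *\<^sub>R u n)"
      by (simp add: algebra_simps)
    ultimately show ?thesis
      using norm_diff_square_le[of "v m - l *\<^sub>R u m" "v n - l *\<^sub>R u n"] uv(4)[of m] uv(4)[of n] by simp
  qed
  have "Cauchy u"
  proof (rule metric_CauchyI)
    fix e :: real assume e: "e > 0"
    obtain N :: nat where N: "4 / (\<epsilon> * e\<^sup>2) < real N" using reals_Archimedean2 by blast
    have "dist (u m) (u n) < e" if "m \<ge> N" "n \<ge> N" for m n
    proof -
      have N0: "0 < real N" using N assms(1) e by (smt (verit) divide_nonneg_nonneg mult_nonneg_nonneg zero_le_power2)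
      have "2 / real (Suc m) \<le> 2 / real N" "2 / real (Suc n) \<le> 2 / real N"
        using that N0 by (auto intro!: divide_left_mono)
      then have "\<epsilon> * (norm (u m - u n))\<^sup>2 \<le> 4 / real N" using est[of m n] by linarith
      also have "\<dots> < \<epsilon> * e\<^sup>2" using N N0 assms(1) e by (simp add: field_simps)
      finally have "(norm (u m - u n))\<^sup>2 < e\<^sup>2" using assms(1) by simp
      then show ?thesis using e by (simp add: dist_norm power_less_imp_less_base)
    qed
    then show "\<exists>M. \<forall>m\<ge>M. \<forall>n\<ge>M. dist (u m) (u n) < e" by blast
  qed
  then obtain f where f: "u \<longlonglongrightarrow> f" using Cauchy_convergent_iff convergent_def by blast
  have "(\<lambda>n. norm (v n - l *\<^sub>R u n)) \<longlonglongrightarrow> 0"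
  proof -
    have "(\<lambda>n. (norm (v n - l *\<^sub>R u n))\<^sup>2) \<longlonglongrightarrow> 0"
    proof (rule tendsto_sandwich)
      show "\<forall>\<^sub>F n in sequentially. 0 \<le> (norm (v n - l *\<^sub>R u n))\<^sup>2" by simp
      show "\<forall>\<^sub>F n in sequentially. (norm (v n - l *\<^sub>R u n))\<^sup>2 \<le> 1 / real (Suc n)"
      proof (intro always_eventually allI)
        show "(norm (v n - l *\<^sub>R u n))\<^sup>2 \<le> 1 / real (Suc n)" for n
          using uv(4)[of n] list_form_nonneg[of L "u n"] by linarith
      qed
      show "(\<lambda>n. 1 / real (Suc n)) \<longlonglongrightarrow> 0" by (rule LIMSEQ_Suc[OF lim_1_over_n])
    qed simp
    then show ?thesis using tendsto_real_sqrt by fastforce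
  qed
  then have "(\<lambda>n. v n - l *\<^sub>R u n) \<longlonglongrightarrow> 0" by (rule tendsto_norm_zero_cancel)
  then have "(\<lambda>n. (v n - l *\<^sub>R u n) + l *\<^sub>R u n) \<longlonglongrightarrow> 0 + l *\<^sub>R f" using f by (intro tendsto_intros)
  then have "(f, l *\<^sub>R f) \<in> T" using lim_mem[OF uv(1) f] by simp
  then have fE: "f \<in> eigenspace_rel T l" by (simp add: eigenspace_rel_iff)
  have "(\<lambda>n. u n \<bullet> f) \<longlonglongrightarrow> f \<bullet> f" using f by (intro tendsto_intros)
  then have "f \<bullet> f = 0" using uv(2)[OF fE] by (simp add: LIMSEQ_const_iff)
  moreover have "(\<lambda>n. u n \<bullet> \<phi>) \<longlonglongrightarrow> f \<bullet> \<phi>" using f by (intro tendsto_intros)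
  then have "f \<bullet> \<phi> = 1" using uv(3) by (simp add: LIMSEQ_const_iff)
  ultimately show False by simp
qed

end

section \<open>Isolated points of the spectrum\<close>

text \<open>Nonnegativity is tested at u - t V u; the value t = 1 / N minimizes the resulting upper
  bound - 2 t + t^2 N for the coefficient of the squared norm of V u.\<close>

lemma nonneg_symmetric_square_le:
  fixes V :: "'a::real_inner \<Rightarrow> 'a"
  assumes "linear V" and sym: "\<And>u v. V u \<bullet> v = u \<bullet> V v"
    and nonneg: "\<And>u. 0 \<le> V u \<bullet> u" and upper: "\<And>u. V u \<bullet> u \<le> N * (norm u)\<^sup>2" and "N > 0"
  shows "(norm (V u))\<^sup>2 \<le> N * (V u \<bullet> u)"
proof -
  interpret V: linear V by fact
  define t where "t = 1 / N"
  have "0 \<le> V (u - t *\<^sub>R V u) \<bullet> (u - t *\<^sub>R V u)" by (rule nonneg)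
  also have "\<dots> = V u \<bullet> u - 2 * t * (norm (V u))\<^sup>2 + t\<^sup>2 * (V (V u) \<bullet> V u)"
    using sym[of "V u" u]
    by (simp add: V.diff V.scale inner_diff_left inner_diff_right dot_square_norm algebra_simps power2_eq_square)
  also have "\<dots> \<le> V u \<bullet> u - 2 * t * (norm (V u))\<^sup>2 + t\<^sup>2 * (N * (norm (V u))\<^sup>2)"
    using upper[of "V u"] by (simp add: mult_left_mono)
  also have "\<dots> = V u \<bullet> u - (norm (V u))\<^sup>2 / N"
    using \<open>N > 0\<close> by (simp add: t_def power2_eq_square field_simps)
  finally show ?thesis using \<open>N > 0\<close> by (simp add: field_simps)
qed

text \<open>Isolation of 0 in the spectrum of Y means that W = Y^2 has no spectrum in (0, r^2), so the
  distance from r^2/2 to the spectrum of W is r^2/2; squaring this bound gives |Wu|^2 >= r^2 (Wu,u),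
  which says |Yv| >= r|v| on the range of Y.\<close>
lemma symmetric_isolated_zero_gap:
  fixes Y :: "'a::{real_inner, complete_space} \<Rightarrow> 'a"
  assumes lin: "linear Y" and sym: "\<And>u v. Y u \<bullet> v = u \<bullet> Y v" and bdd: "\<And>u. norm (Y u) \<le> M * norm u"
    and r: "r > 0" and reg: "\<And>y. 0 < \<bar>y\<bar> \<Longrightarrow> \<bar>y\<bar> < r \<Longrightarrow> \<exists>c>0. \<forall>u. c * norm u \<le> norm (Y u - y *\<^sub>R u)"
    and v: "\<And>e. Y e = 0 \<Longrightarrow> v \<bullet> e = 0"
  shows "r * norm v \<le> norm (Y v)"
proof -
  interpret Y: linear Y by fact
  \<comment> \<open>With s = sqrt t, the operator Y^2 - t factors as (Y - s)(Y + s), and both s and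
    -s are regular.\<close>
  have regW: "\<exists>c>0. \<forall>u. c * norm u \<le> norm (Y (Y u) - t *\<^sub>R u)" if t: "0 < t" "t < r\<^sup>2" for t
  proof -
    define s where "s = sqrt t"
    have s: "0 < s" "s < r" "s * s = t" using t r by (auto simp: s_def real_less_lsqrt)
    obtain c1 where c1: "c1 > 0" "\<And>u. c1 * norm u \<le> norm (Y u - s *\<^sub>R u)" using reg[of s] s by auto
    obtain c2 where c2: "c2 > 0" "\<And>u. c2 * norm u \<le> norm (Y u - (-s) *\<^sub>R u)" using reg[of "-s"] s by auto
    have "c1 * c2 * norm u \<le> norm (Y (Y u) - t *\<^sub>R u)" for u
    proof -
      define z where "z = Y u - (-s) *\<^sub>R u"
      have "Y (Y u) - t *\<^sub>R u = Y z - s *\<^sub>R z"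
        by (simp add: z_def Y.add Y.scale algebra_simps s(3)[symmetric])
      moreover have "c1 * (c2 * norm u) \<le> c1 * norm z" using c1(1) c2(2)[of u] by (simp add: z_def)
      ultimately show ?thesis using c1(2)[of z] by simp
    qed
    then show ?thesis using c1(1) c2(1) by (intro exI[of _ "c1 * c2"]) auto
  qed
  define k where "k = r\<^sup>2 / 2"
  have k: "k > 0" using r by (simp add: k_def)
  define S where "S u = Y (Y u) - k *\<^sub>R u" for u
  have linS: "linear S"
    by (rule linearI) (simp_all add: S_def Y.add Y.scale algebra_simps)
  interpret S: linear S by fact
  have symS: "S u \<bullet> w = u \<bullet> S w" for u w
    by (simp add: S_def inner_diff_left inner_diff_right sym)
  have bddS: "norm (S u) \<le> (M\<^sup>2 + k) * norm u" for u
  proof (cases "u = 0")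
    case False
    have M: "M \<ge> 0" using bdd[of u] False by (smt (verit) norm_ge_zero zero_less_norm_iff mult_neg_pos)
    have "norm (S u) \<le> norm (Y (Y u)) + norm (k *\<^sub>R u)" unfolding S_def by (rule norm_triangle_ineq4)
    also have "norm (Y (Y u)) \<le> M * (M * norm u)"
      using bdd[of "Y u"] mult_left_mono[OF bdd[of u] M] by linarith
    finally show ?thesis using k by (simp add: power2_eq_square algebra_simps)
  qed simp
  \<comment> \<open>Let c0 be the best lower bound of S. If c0 < k, then k - c0 and k + c0 both lie
    in the gap of Y^2, so V = S^2 - c0^2 = (S - c0)(S + c0) is bounded below in norm. V is also
    nonnegative, hence its form is bounded below by some d > 0, and this improves c0.\<close>
  have gapS: "k * norm u \<le> norm (S u)" for u
  proof (rule ccontr)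
    assume "\<not> ?thesis"
    then have u: "norm (S u) < k * norm u" by simp
    then have nu: "norm u > 0" using k by (smt (verit) norm_ge_zero zero_less_mult_pos)
    define C where "C = {c. 0 \<le> c \<and> (\<forall>w. c * norm w \<le> norm (S w))}"
    define c0 where "c0 = Sup C"
    have C0: "0 \<in> C" by (simp add: C_def)
    have up: "c \<le> norm (S w) / norm w" if "c \<in> C" "w \<noteq> 0" for c w
      using that by (simp add: C_def field_simps)
    have bC: "bdd_above C" using up[of _ u] nu by (intro bdd_aboveI) auto
    have c0le: "c0 \<le> norm (S w) / norm w" if "w \<noteq> 0" for w
      unfolding c0_def using C0 up that by (intro cSup_least) auto
    have "c0 * norm u \<le> norm (S u)" using c0le[of u] nu by (simp add: field_simps)
    then have "c0 * norm u < k * norm u" using u by linarith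
    then have c0k: "c0 < k" using nu mult_less_cancel_right_pos by blast
    have c00: "0 \<le> c0" unfolding c0_def using C0 bC by (rule cSup_upper)
    have c0S: "c0 * norm w \<le> norm (S w)" for w
      using c0le[of w] by (cases "w = 0") (simp_all add: field_simps)
    define V where "V w = S (S w) - c0\<^sup>2 *\<^sub>R w" for w
    have linV: "linear V" by (rule linearI) (simp_all add: V_def S.add S.scale algebra_simps)
    have symV: "V u \<bullet> w = u \<bullet> V w" for u w
      by (simp add: V_def inner_diff_left inner_diff_right symS)
    have formV: "V w \<bullet> w = (norm (S w))\<^sup>2 - c0\<^sup>2 * (norm w)\<^sup>2" for w
      by (simp add: V_def inner_diff_left symS power2_norm_eq_inner)
    have nonneg: "0 \<le> V w \<bullet> w" for w
      using power_mono[OF c0S, of w 2] c00 by (simp add: formV power_mult_distrib)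
    define N where "N = (M\<^sup>2 + k)\<^sup>2"
    have N: "N > 0" unfolding N_def using k by (smt (verit) zero_le_power2 zero_less_power)
    have upper: "V w \<bullet> w \<le> N * (norm w)\<^sup>2" for w
      using power_mono[OF bddS norm_ge_zero, of w 2] zero_le_power2[of "c0 * norm w"]
      unfolding formV N_def power_mult_distrib by linarith
    have "k - c0 > 0" "k - c0 < r\<^sup>2" "k + c0 > 0" "k + c0 < r\<^sup>2"
      using c0k c00 k by (auto simp: k_def)
    then obtain c1 c2 where c1: "c1 > 0" "\<And>u. c1 * norm u \<le> norm (Y (Y u) - (k - c0) *\<^sub>R u)"
      and c2: "c2 > 0" "\<And>u. c2 * norm u \<le> norm (Y (Y u) - (k + c0) *\<^sub>R u)"
      using regW[of "k - c0"] regW[of "k + c0"] by blast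
    have Vlow: "c2 * c1 * norm w \<le> norm (V w)" for w
    proof -
      define z where "z = Y (Y w) - (k - c0) *\<^sub>R w"
      have z: "z = S w + c0 *\<^sub>R w" by (simp add: z_def S_def algebra_simps)
      have "V w = S z - c0 *\<^sub>R z" by (simp add: V_def z S.add S.scale algebra_simps power2_eq_square)
      also have "\<dots> = Y (Y z) - (k + c0) *\<^sub>R z" by (simp add: S_def algebra_simps)
      finally have "c2 * norm z \<le> norm (V w)" using c2(2)[of z] by simp
      moreover have "c2 * (c1 * norm w) \<le> c2 * norm z" using c1(2)[of w] c2(1) by (simp add: z_def)
      ultimately show ?thesis by simp
    qed
    \<comment> \<open>Combines the norm bound c2 c1 for V with
      \<open>nonneg_symmetric_square_le\<close>.\<close>
    define d where "d = (c2 * c1)\<^sup>2 / N"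
    have d: "d > 0" using c1(1) c2(1) N by (simp add: d_def)
    have "sqrt (c0\<^sup>2 + d) * norm w \<le> norm (S w)" for w
    proof -
      have "(c2 * c1)\<^sup>2 * (norm w)\<^sup>2 \<le> (norm (V w))\<^sup>2"
        using power_mono[OF Vlow, of w 2] c1(1) c2(1) by (simp add: power_mult_distrib)
      also have "\<dots> \<le> N * (V w \<bullet> w)"
        by (rule nonneg_symmetric_square_le[OF linV symV nonneg upper N])
      finally have "d * (norm w)\<^sup>2 \<le> V w \<bullet> w" using N by (simp add: d_def field_simps)
      then have "(c0\<^sup>2 + d) * (norm w)\<^sup>2 \<le> (norm (S w))\<^sup>2" by (simp add: formV algebra_simps)
      then have "sqrt ((c0\<^sup>2 + d) * (norm w)\<^sup>2) \<le> norm (S w)" by (simp add: real_le_lsqrt)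
      then show ?thesis by (simp add: real_sqrt_mult)
    qed
    then have "sqrt (c0\<^sup>2 + d) \<in> C" using d by (simp add: C_def)
    then have "sqrt (c0\<^sup>2 + d) \<le> c0" unfolding c0_def using bC by (rule cSup_upper)
    then have "c0\<^sup>2 + d \<le> c0\<^sup>2" by (metis c00 real_sqrt_le_iff real_sqrt_abs abs_of_nonneg)
    with d show False by simp
  qed
  have gapY: "r * norm (Y u) \<le> norm (Y (Y u))" for u
  proof -
    have "k\<^sup>2 * (norm u)\<^sup>2 \<le> (norm (S u))\<^sup>2"
      using power_mono[OF gapS, of u 2] k by (simp add: power_mult_distrib)
    also have "\<dots> = (norm (Y (Y u)))\<^sup>2 - 2 * k * (norm (Y u))\<^sup>2 + k\<^sup>2 * (norm u)\<^sup>2"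
      using sym[of "Y u" u]
      by (simp add: S_def norm_diff_scaleR_square power2_norm_eq_inner[of "Y u"] power2_norm_eq_inner[of u]
          power2_eq_square[of k])
    finally have "(r * norm (Y u))\<^sup>2 \<le> (norm (Y (Y u)))\<^sup>2" by (simp add: k_def power_mult_distrib)
    then show ?thesis by (rule power2_le_imp_le) simp
  qed
  \<comment> \<open>Being orthogonal to the kernel, v is a limit of vectors in the range, where
    \<open>gapY\<close> applies; the bound passes to the limit.\<close>
  have "v \<in> closure (range Y)"
  proof (rule mem_closure_if_orthogonal[where W = "{e. Y e = 0}"])
    show "subspace (range Y)" using lin by (simp add: linear_subspace_image)
    show "x \<in> {e. Y e = 0}" if "\<And>w. w \<in> range Y \<Longrightarrow> x \<bullet> w = 0" for x
      using that[of "Y (Y x)"] sym[of x "Y x"] by simp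
    show "v \<bullet> w = 0" if "w \<in> {e. Y e = 0}" for w using v that by simp
  qed
  then obtain w where w: "\<And>n. w n \<in> range Y" "w \<longlonglongrightarrow> v" by (metis closure_sequential)
  have "bounded_linear Y" using bdd lin
    by (intro bounded_linear_intro[of _ M]) (simp_all add: Y.add Y.scale mult.commute)
  then have "(\<lambda>n. norm (Y (w n))) \<longlonglongrightarrow> norm (Y v)" 
    by (intro tendsto_norm bounded_linear.tendsto[OF _ w(2)])
  moreover have "(\<lambda>n. r * norm (w n)) \<longlonglongrightarrow> r * norm v" using w(2) by (intro tendsto_intros)
  moreover have "r * norm (w n) \<le> norm (Y (w n))" for n using w(1)[of n] gapY by auto
  ultimately show ?thesis using LIMSEQ_le by blast
qed

section \<open>Spectral gaps and approximate eigenvectors\<close>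

context sa_relation
begin

text \<open>For \<delta> > 0 this covers regular points and isolated points of the spectrum at
  once.\<close>

definition gap_at :: "real \<Rightarrow> real \<Rightarrow> bool" where
  "gap_at l \<delta> \<longleftrightarrow> (\<forall>f g. (f, g) \<in> T \<longrightarrow> (\<forall>e\<in>eigenspace_rel T l. f \<bullet> e = 0) \<longrightarrow>
     \<delta> * norm f \<le> norm (g - l *\<^sub>R f))"

text \<open>T - \<mu> maps the components of f along and off the eigenspace to orthogonal vectors.
  The lower bound is |\<mu> - l| on the first and \<delta> - |\<mu> - l| on the second, and the
  latter is no smaller because |\<mu> - l| is at most \<delta> / 2.\<close>

lemma regular_near_gap:
  assumes "gap_at l \<delta>" "\<mu> \<noteq> l" "\<bar>\<mu> - l\<bar> \<le> \<delta> / 2"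
  shows "regular_at \<mu>"
proof -
  have "\<bar>\<mu> - l\<bar> * norm f \<le> norm (g - \<mu> *\<^sub>R f)" if fg: "(f, g) \<in> T" for f g
  proof -
    obtain e f' where e: "e \<in> eigenspace_rel T l" "f = e + f'" and f': "(f', g - l *\<^sub>R e) \<in> T"
      and orth: "\<And>x. x \<in> eigenspace_rel T l \<Longrightarrow> f' \<bullet> x = 0"
      using eigenspace_decomp[OF fg] by metis
    define g' where "g' = g - l *\<^sub>R e"
    have "\<delta> * norm f' \<le> norm (g' - l *\<^sub>R f')" using assms(1) f' orth by (auto simp: gap_at_def g'_def)
    also have "g' - l *\<^sub>R f' = (g' - \<mu> *\<^sub>R f') + (\<mu> - l) *\<^sub>R f'" by (simp add: algebra_simps)
    also have "norm \<dots> \<le> norm (g' - \<mu> *\<^sub>R f') + \<bar>\<mu> - l\<bar> * norm f'"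
      by (metis norm_triangle_ineq norm_scaleR)
    finally have "(\<delta> - \<bar>\<mu> - l\<bar>) * norm f' \<le> norm (g' - \<mu> *\<^sub>R f')" by (simp add: algebra_simps)
    moreover have "\<bar>\<mu> - l\<bar> * norm f' \<le> (\<delta> - \<bar>\<mu> - l\<bar>) * norm f'"
      using assms(3) by (intro mult_right_mono) auto
    ultimately have 1: "(\<bar>\<mu> - l\<bar> * norm f')\<^sup>2 \<le> (norm (g' - \<mu> *\<^sub>R f'))\<^sup>2" by (intro power_mono) auto
    have "(g' - \<mu> *\<^sub>R f') \<bullet> ((l - \<mu>) *\<^sub>R e) = 0"
      using eigenspace_orth[OF f' e(1)] orth[OF e(1)] by (simp add: g'_def inner_diff_left)
    then have "(norm ((g' - \<mu> *\<^sub>R f') + (l - \<mu>) *\<^sub>R e))\<^sup>2 = (norm (g' - \<mu> *\<^sub>R f'))\<^sup>2 + (norm ((l - \<mu>) *\<^sub>R e))\<^sup>2"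
      by (intro norm_add_Pythagorean) (simp add: orthogonal_def)
    moreover have "(g' - \<mu> *\<^sub>R f') + (l - \<mu>) *\<^sub>R e = g - \<mu> *\<^sub>R f" by (simp add: g'_def e(2) algebra_simps)
    moreover have "(norm f)\<^sup>2 = (norm e)\<^sup>2 + (norm f')\<^sup>2"
      unfolding e(2) using orth[OF e(1)] by (intro norm_add_Pythagorean) (simp add: orthogonal_def inner_commute)
    moreover have "(norm ((l - \<mu>) *\<^sub>R e))\<^sup>2 = (\<mu> - l)\<^sup>2 * (norm e)\<^sup>2"
      by (simp add: power_mult_distrib power2_commute)
    ultimately have "(\<bar>\<mu> - l\<bar> * norm f)\<^sup>2 \<le> (norm (g - \<mu> *\<^sub>R f))\<^sup>2"
      using 1 by (simp only: power_mult_distrib power2_abs distrib_left)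
    then show ?thesis by (rule power2_le_imp_le) simp
  qed
  then show ?thesis unfolding regular_at_def using assms(2) by (intro exI[of _ "\<bar>\<mu> - l\<bar>"]) auto
qed

text \<open>A form of Weyl's criterion: instead of an orthonormal sequence, approximate eigenvectors
  nearly annihilated by any prescribed list. Otherwise \<open>drop_coordinate\<close> removes the
  list entry by entry and leaves a gap at l, while the full list separates the eigenspace and so
  bounds its dimension; l would be discrete.\<close>

lemma ess_spectrum_approx:
  assumes "l \<in> sa_ess_spectrum T" "\<epsilon> > 0"
  obtains f g where "(f, g) \<in> T" "(norm (g - l *\<^sub>R f))\<^sup>2 + list_form L f < \<epsilon> * (norm f)\<^sup>2"
proof (rule ccontr)
  assume "\<not> ?thesis"
  then have bound: "\<And>f g. (f, g) \<in> T \<Longrightarrow> \<epsilon> * (norm f)\<^sup>2 \<le> (norm (g - l *\<^sub>R f))\<^sup>2 + list_form L f"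
    using that by (meson not_less)
  define P where "P L \<longleftrightarrow> (\<exists>\<epsilon>>0. \<forall>f g. (f, g) \<in> T \<longrightarrow> (\<forall>e\<in>eigenspace_rel T l. f \<bullet> e = 0) \<longrightarrow>
      \<epsilon> * (norm f)\<^sup>2 \<le> (norm (g - l *\<^sub>R f))\<^sup>2 + list_form L f)" for L
  have "P L \<Longrightarrow> P []" for L
  proof (induction L)
    case (Cons \<phi> L)
    then obtain \<epsilon> where \<epsilon>: "\<epsilon> > 0" "\<forall>f g. (f, g) \<in> T \<longrightarrow> (\<forall>e\<in>eigenspace_rel T l. f \<bullet> e = 0) \<longrightarrow>
      \<epsilon> * (norm f)\<^sup>2 \<le> (norm (g - l *\<^sub>R f))\<^sup>2 + list_form (\<phi> # L) f"
      unfolding P_def by (elim exE conjE) rule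
    have "P L" unfolding P_def
    proof (rule drop_coordinate[OF \<epsilon>(1)])
      fix f g assume "(f, g) \<in> T" "\<And>e. e \<in> eigenspace_rel T l \<Longrightarrow> f \<bullet> e = 0"
      then show "\<epsilon> * (norm f)\<^sup>2 \<le> (norm (g - l *\<^sub>R f))\<^sup>2 + list_form (\<phi> # L) f"
        using \<epsilon>(2)[rule_format, of f g] by blast
    qed
    then show ?case by (rule Cons.IH)
  qed
  moreover have "P L" unfolding P_def using bound assms(2) by blast
  ultimately have "P []" by blast
  then obtain \<epsilon>' where \<epsilon>': "\<epsilon>' > 0" "\<And>f g. (f, g) \<in> T \<Longrightarrow> (\<forall>e\<in>eigenspace_rel T l. f \<bullet> e = 0) \<Longrightarrow>
      \<epsilon>' * (norm f)\<^sup>2 \<le> (norm (g - l *\<^sub>R f))\<^sup>2"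
    unfolding P_def list_form_Nil add_0_right by blast
  define \<delta> where "\<delta> = sqrt \<epsilon>'"
  have \<delta>: "\<delta> > 0" using \<epsilon>'(1) by (simp add: \<delta>_def)
  have gap: "gap_at l \<delta>"
    unfolding gap_at_def
  proof (intro allI impI)
    fix f g assume "(f, g) \<in> T" "\<forall>e\<in>eigenspace_rel T l. f \<bullet> e = 0"
    from \<epsilon>'(2)[OF this] have "(\<delta> * norm f)\<^sup>2 \<le> (norm (g - l *\<^sub>R f))\<^sup>2"
      using \<epsilon>'(1) by (simp add: \<delta>_def power_mult_distrib)
    then show "\<delta> * norm f \<le> norm (g - l *\<^sub>R f)" by (rule power2_le_imp_le) simp
  qed
  have "f = 0" if "f \<in> eigenspace_rel T l" "\<And>\<phi>. \<phi> \<in> set L \<Longrightarrow> f \<bullet> \<phi> = 0" for f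
  proof -
    have "list_form L f = 0" using that(2) by (induction L) auto
    then have "\<epsilon> * (norm f)\<^sup>2 \<le> 0" using bound[of f "l *\<^sub>R f"] that(1) by (simp add: eigenspace_rel_iff)
    then show ?thesis using assms(2) by (simp add: mult_le_0_iff)
  qed
  then obtain B where B: "finite B" "eigenspace_rel T l \<subseteq> span B"
    using finite_dim_if_separated_by_list[OF subspace_eigenspace] by metis
  have "\<mu> = l" if "\<mu> \<in> sa_spectrum T" "\<mu> \<in> {l - \<delta> / 2<..<l + \<delta> / 2}" for \<mu>
  proof (rule ccontr)
    assume "\<mu> \<noteq> l"
    moreover have "\<bar>\<mu> - l\<bar> \<le> \<delta> / 2"
      using that(2) unfolding greaterThanLessThan_iff by linarith
    ultimately have "regular_at \<mu>" by (rule regular_near_gap[OF gap])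
    with that(1) show False using not_in_spectrum_iff by blast
  qed
  moreover have "l \<in> sa_spectrum T" using assms(1) by (simp add: sa_ess_spectrum_def)
  ultimately have "sa_spectrum T \<inter> {l - \<delta> / 2<..<l + \<delta> / 2} = {l}" using \<delta> by auto
  then have "l \<in> sa_disc_spectrum T"
    unfolding sa_disc_spectrum_def using B \<delta> assms(1)
    by (auto simp: sa_ess_spectrum_def intro!: exI[of _ "\<delta> / 2"])
  then show False using assms(1) by (simp add: sa_ess_spectrum_def)
qed

text \<open>Spectral mapping by hand: the resolvent X at \<mu>0 sends the isolated point l to x0 = 1
  / (l - \<mu>0), so 0 is isolated or regular for the bounded symmetric operator Y = X - x0. The gap
  of Y at 0 is then translated back to T.\<close>

lemma isolated_imp_gap:
  assumes e: "e > 0" and reg: "\<And>\<mu>. \<mu> \<noteq> l \<Longrightarrow> \<bar>\<mu> - l\<bar> < e \<Longrightarrow> regular_at \<mu>"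
  obtains \<delta> where "\<delta> > 0" "gap_at l \<delta>"
proof -
  define \<mu>0 where "\<mu>0 = l + e / 2"
  have reg0: "regular_at \<mu>0" using e by (intro reg) (auto simp: \<mu>0_def)
  then obtain c where c: "c > 0" "\<And>f g. (f, g) \<in> T \<Longrightarrow> c * norm f \<le> norm (g - \<mu>0 *\<^sub>R f)"
    unfolding regular_at_def by blast
  have "\<exists>f. (f, u + \<mu>0 *\<^sub>R f) \<in> T" for u using surj_if_regular[OF reg0] by blast
  then obtain X where X: "\<And>u. (X u, u + \<mu>0 *\<^sub>R X u) \<in> T" by metis
  have X_unique: "X u = f" if "(f, u + \<mu>0 *\<^sub>R f) \<in> T" for f u
    using c(2)[OF diff_mem[OF X[of u] that]] c(1) by (simp add: algebra_simps mult_le_0_iff)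
  have X_add: "X (u + w) = X u + X w" for u w
    using add_mem[OF X[of u] X[of w]] by (intro X_unique) (simp add: algebra_simps)
  have X_scale: "X (a *\<^sub>R u) = a *\<^sub>R X u" for a u
    using scale_mem[OF X[of u], of a] by (intro X_unique) (simp add: algebra_simps)
  have X_sym: "X u \<bullet> w = u \<bullet> X w" for u w
    using symm[OF X[of u] X[of w]] by (simp add: inner_add_left inner_add_right)
  have X_bdd: "norm (X u) \<le> (1 / c) * norm u" for u
    using c(2)[OF X[of u]] c(1) by (simp add: field_simps)
  define x0 where "x0 = - 2 / e"
  have x0: "x0 * (l - \<mu>0) = 1" "x0 \<noteq> 0" using e by (auto simp: x0_def \<mu>0_def)
  define Y where "Y u = X u - x0 *\<^sub>R u" for u
  have gapY: "(1 / e) * norm v \<le> norm (Y v)" if v: "\<And>w. Y w = 0 \<Longrightarrow> v \<bullet> w = 0" for v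
  proof (rule symmetric_isolated_zero_gap[where M = "1 / c + \<bar>x0\<bar>" and Y = Y])
    show "linear Y" by (rule linearI) (simp_all add: Y_def X_add X_scale algebra_simps)
    show "Y u \<bullet> w = u \<bullet> Y w" for u w by (simp add: Y_def inner_diff_left inner_diff_right X_sym)
    show "norm (Y u) \<le> (1 / c + \<bar>x0\<bar>) * norm u" for u
      using norm_triangle_ineq4[of "X u" "x0 *\<^sub>R u"] X_bdd[of u] by (simp add: Y_def algebra_simps)
    show "1 / e > 0" using e by simp
    show "\<exists>d>0. \<forall>u. d * norm u \<le> norm (Y u - y *\<^sub>R u)" if y: "0 < \<bar>y\<bar>" "\<bar>y\<bar> < 1 / e" for y
    proof -
      \<comment> \<open>The value x0 + y for X corresponds to the point \<mu> for T with x0 + y = 1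
        / (\<mu> - \<mu>0); the radius 1 / e for y keeps \<mu> within e of l.\<close>
      define s where "s = x0 + y"
      define \<mu> where "\<mu> = \<mu>0 + 1 / s"
      have ye: "- 1 < y * e" "y * e < 1" "y * e \<noteq> 0"
      proof -
        have "\<bar>y * e\<bar> < 1" using y(2) e by (simp add: abs_mult field_simps)
        then show "- 1 < y * e" "y * e < 1" by linarith+
        show "y * e \<noteq> 0" using y(1) e by auto
      qed
      have se: "s * e = y * e - 2" using e by (simp add: s_def x0_def algebra_simps)
      then have s0: "s \<noteq> 0" using ye by auto
      have inv: "1 / s = e / (y * e - 2)" using e s0 by (simp add: se[symmetric])
      have "\<mu> - l = e * (y * e) / (2 * (y * e - 2))"
        unfolding \<mu>_def \<mu>0_def inv using ye by (simp add: field_simps)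
      moreover have "\<bar>e * (y * e) / (2 * (y * e - 2))\<bar> < e"
      proof -
        define z where "z = y * e"
        have z: "\<bar>z\<bar> < 1" "1 < \<bar>z - 2\<bar>" using ye(1,2) by (simp_all add: z_def[symmetric] abs_less_iff abs_if)
        have "e * \<bar>z\<bar> < e * (2 * \<bar>z - 2\<bar>)" using z e by (intro mult_strict_left_mono) auto
        moreover have "\<bar>e * z / (2 * (z - 2))\<bar> = e * \<bar>z\<bar> / (2 * \<bar>z - 2\<bar>)"
          using e by (simp only: abs_mult abs_divide abs_numeral abs_of_pos)
        ultimately show ?thesis unfolding z_def[symmetric] using z(2) by (simp add: pos_divide_less_eq)
      qed
      moreover have "e * (y * e) / (2 * (y * e - 2)) \<noteq> 0"
      proof -
        have "y * e - 2 \<noteq> 0" using ye(2) by linarith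
        then show ?thesis using ye(3) e by (simp add: mult.commute)
      qed
      ultimately have "regular_at \<mu>" by (intro reg) auto
      then obtain c' where c': "c' > 0" "\<And>f g. (f, g) \<in> T \<Longrightarrow> c' * norm f \<le> norm (g - \<mu> *\<^sub>R f)"
        unfolding regular_at_def by blast
      \<comment> \<open>Comes from X - s = - s (T - \<mu>) X: the residual D bounds X u through c',
        and s u = X u - D then bounds u.\<close>
      define d where "d = \<bar>s\<bar> / (1 + 1 / (\<bar>s\<bar> * c'))"
      have d: "d > 0" using s0 c'(1) by (simp add: d_def add_pos_pos)
      have "d * norm u \<le> norm (Y u - y *\<^sub>R u)" for u
      proof -
        define D where "D = X u - s *\<^sub>R u"
        have D: "D = Y u - y *\<^sub>R u" by (simp add: D_def Y_def s_def algebra_simps)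
        have "D = (- s) *\<^sub>R ((u + \<mu>0 *\<^sub>R X u) - \<mu> *\<^sub>R X u)"
          using s0 by (simp add: D_def \<mu>_def algebra_simps)
        then have "norm D = \<bar>s\<bar> * norm ((u + \<mu>0 *\<^sub>R X u) - \<mu> *\<^sub>R X u)" by simp
        then have "\<bar>s\<bar> * (c' * norm (X u)) \<le> norm D" using c'(2)[OF X[of u]] by (simp add: mult_left_mono)
        then have Xu: "norm (X u) \<le> norm D / (\<bar>s\<bar> * c')" using s0 c'(1) by (simp add: field_simps)
        have "s *\<^sub>R u = X u - D" by (simp add: D_def)
        then have "\<bar>s\<bar> * norm u \<le> norm (X u) + norm D" by (metis norm_scaleR norm_triangle_ineq4)
        also have "\<dots> \<le> (1 + 1 / (\<bar>s\<bar> * c')) * norm D" using Xu by (simp add: algebra_simps)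
        finally have "\<bar>s\<bar> * norm u \<le> (1 + 1 / (\<bar>s\<bar> * c')) * norm D" .
        moreover have "1 + 1 / (\<bar>s\<bar> * c') > 0" using s0 c'(1) by (simp add: add_pos_pos)
        ultimately have "d * norm u \<le> norm D" unfolding d_def by (simp add: pos_divide_le_eq mult.commute)
        then show ?thesis by (simp add: D)
      qed
      with d show ?thesis by blast
    qed
  qed (use v in auto)
  \<comment> \<open>For u = (T - \<mu>0) f one has Y u = - x0 (T - l) f. The factor 1 / e is the gap
    of Y, and c compares f with u.\<close>
  define \<delta> where "\<delta> = c / (e * \<bar>x0\<bar>)"
  have "\<delta> * norm f \<le> norm (g - l *\<^sub>R f)"
    if fg: "(f, g) \<in> T" and orth: "\<And>x. x \<in> eigenspace_rel T l \<Longrightarrow> f \<bullet> x = 0" for f g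
  proof -
    define u where "u = g - \<mu>0 *\<^sub>R f"
    have Xu: "X u = f" using fg by (intro X_unique) (simp add: u_def)
    \<comment> \<open>The kernel of Y consists of eigenvectors of T at l, so orthogonality to the
      eigenspace passes from f to u.\<close>
    have "u \<bullet> w = 0" if "Y w = 0" for w
    proof -
      have "X w = x0 *\<^sub>R w" using that by (simp add: Y_def)
      then have "(x0 *\<^sub>R w, w + \<mu>0 *\<^sub>R x0 *\<^sub>R w) \<in> T" using X[of w] by simp
      from scale_mem[OF this, of "l - \<mu>0"]
      have "(((l - \<mu>0) * x0) *\<^sub>R w, (l - \<mu>0) *\<^sub>R w + (\<mu>0 * ((l - \<mu>0) * x0)) *\<^sub>R w) \<in> T"
        by (simp add: scaleR_add_right mult.left_commute mult.assoc)
      moreover have "(l - \<mu>0) * x0 = 1" using x0(1) by (simp add: mult.commute)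
      ultimately have "w \<in> eigenspace_rel T l"
        by (simp add: eigenspace_rel_iff scaleR_add_left[symmetric])
      then show ?thesis using eigenspace_orth[OF fg] orth by (simp add: u_def inner_diff_left)
    qed
    from gapY[OF this] have "(1 / e) * norm u \<le> norm (f - x0 *\<^sub>R u)" by (simp add: Y_def Xu)
    also have "f - x0 *\<^sub>R u = (x0 * (l - \<mu>0)) *\<^sub>R f - x0 *\<^sub>R u" by (simp add: x0(1))
    also have "\<dots> = (- x0) *\<^sub>R (g - l *\<^sub>R f)" by (simp add: u_def algebra_simps)
    finally have 1: "(1 / e) * norm u \<le> \<bar>x0\<bar> * norm (g - l *\<^sub>R f)" by simp
    have "c * norm f \<le> norm u" using c(2)[OF fg] by (simp add: u_def)
    then have "(1 / e) * (c * norm f) \<le> (1 / e) * norm u" using e by (intro mult_left_mono) auto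
    with 1 have "(1 / e) * (c * norm f) \<le> \<bar>x0\<bar> * norm (g - l *\<^sub>R f)" by linarith
    then show ?thesis using e x0(2) by (simp add: \<delta>_def field_simps)
  qed
  moreover have "\<delta> > 0" using c(1) e x0(2) by (simp add: \<delta>_def)
  ultimately show ?thesis using that unfolding gap_at_def by blast
qed

lemma not_ess_spectrumE:
  assumes "l \<notin> sa_ess_spectrum T"
  obtains B \<delta> where "finite B" "eigenspace_rel T l \<subseteq> span B" "\<delta> > 0" "gap_at l \<delta>"
proof (cases "l \<in> sa_spectrum T")
  case True
  then have "l \<in> sa_disc_spectrum T" using assms by (simp add: sa_ess_spectrum_def)
  then obtain e B where e: "e > 0" "sa_spectrum T \<inter> {l - e<..<l + e} = {l}"
    and B: "finite B" "eigenspace_rel T l \<subseteq> span B" unfolding sa_disc_spectrum_def by blast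
  have "regular_at \<mu>" if "\<mu> \<noteq> l" "\<bar>\<mu> - l\<bar> < e" for \<mu>
  proof -
    have "\<mu> \<in> {l - e<..<l + e}" using that(2) by auto
    then have "\<mu> \<notin> sa_spectrum T" using e(2) that(1) by blast
    then show ?thesis by (simp add: not_in_spectrum_iff)
  qed
  then obtain \<delta> where "\<delta> > 0" "gap_at l \<delta>" using isolated_imp_gap[OF e(1)] by metis
  then show ?thesis using that B by blast
next
  case False
  then obtain c where c: "c > 0" "\<And>f g. (f, g) \<in> T \<Longrightarrow> c * norm f \<le> norm (g - l *\<^sub>R f)"
    unfolding not_in_spectrum_iff regular_at_def by blast
  have "eigenspace_rel T l \<subseteq> span {}"
  proof
    fix f assume "f \<in> eigenspace_rel T l"
    then have "c * norm f \<le> 0" using c(2)[of f "l *\<^sub>R f"] by (simp add: eigenspace_rel_iff)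
    then show "f \<in> span {}" using c(1) by (simp add: mult_le_0_iff)
  qed
  moreover have "gap_at l c" using c(2) by (simp add: gap_at_def)
  ultimately show ?thesis using that c(1) by blast
qed

end

section \<open>Form bounds and the bottom of the essential spectrum\<close>

lemma list_form_le:
  obtains C where "C \<ge> 0" "\<And>f. list_form L f \<le> C * (norm f)\<^sup>2"
proof (induction L arbitrary: thesis)
  case Nil
  then show ?case by (metis list_form_Nil mult_zero_left order_refl)
next
  case (Cons \<phi> L)
  obtain C where C: "C \<ge> 0" "\<And>f. list_form L f \<le> C * (norm f)\<^sup>2" using Cons.IH by metis
  have "list_form (\<phi> # L) f \<le> ((norm \<phi>)\<^sup>2 + C) * (norm f)\<^sup>2" for f
  proof -
    have "(f \<bullet> \<phi>)\<^sup>2 \<le> (norm f * norm \<phi>)\<^sup>2"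
      using Cauchy_Schwarz_ineq2[of f \<phi>] power_mono[of "\<bar>f \<bullet> \<phi>\<bar>" "norm f * norm \<phi>" 2] by simp
    then show ?thesis using C(2)[of f] by (simp add: power_mult_distrib algebra_simps)
  qed
  then show ?case using Cons.prems[of "(norm \<phi>)\<^sup>2 + C"] C(1) by simp
qed

text \<open>The vectors spanning a superset of E need not lie in E. Projecting them onto E keeps
  their values on E and makes the functionals blind to its orthogonal complement.\<close>

lemma finite_dim_norm_bound:
  fixes E :: "'a::{real_inner, complete_space} set"
  assumes E: "subspace E" "closed E" and B: "finite B" "E \<subseteq> span B"
  obtains L where "\<And>e f. e \<in> E \<Longrightarrow> (\<And>x. x \<in> E \<Longrightarrow> f \<bullet> x = 0) \<Longrightarrow> (norm e)\<^sup>2 = list_form L (e + f)"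
proof -
  obtain L0 where L0: "\<And>e. e \<in> span B \<Longrightarrow> (norm e)\<^sup>2 = list_form L0 e"
    using finite_dim_norm_list_form[OF B(1)] by metis
  have "\<exists>p\<in>E. \<forall>x\<in>E. (\<phi> - p) \<bullet> x = 0" for \<phi>
    using hilbert_projection[OF E] by metis
  then obtain p where p: "\<And>\<phi>. p \<phi> \<in> E" "\<And>\<phi> x. x \<in> E \<Longrightarrow> (\<phi> - p \<phi>) \<bullet> x = 0" by metis
  have "(norm e)\<^sup>2 = list_form (map p L0) (e + f)" if "e \<in> E" "\<And>x. x \<in> E \<Longrightarrow> f \<bullet> x = 0" for e f
  proof -
    have "list_form L0 e = list_form (map p L0) (e + f)"
    proof (rule list_form_map_eq)
      fix \<phi>
      have "\<phi> \<bullet> e = p \<phi> \<bullet> e" using p(2)[OF that(1), of \<phi>] by (simp add: inner_diff_left)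
      moreover have "f \<bullet> p \<phi> = 0" using p that by auto
      ultimately show "e \<bullet> \<phi> = (e + f) \<bullet> p \<phi>" by (simp add: inner_add_left inner_commute[of e])
    qed
    moreover have "e \<in> span B" using that(1) B(2) by blast
    ultimately show ?thesis using L0 by simp
  qed
  then show ?thesis using that by blast
qed

context sa_relation
begin

text \<open>T is at least b up to a form of finite rank; the empty list gives ordinary
  semiboundedness.\<close>

definition form_bound :: "real \<Rightarrow> bool" where
  "form_bound b \<longleftrightarrow> (\<exists>L. \<forall>f g. (f, g) \<in> T \<longrightarrow> b * (norm f)\<^sup>2 \<le> g \<bullet> f + list_form L f)"

lemma form_bound_mono: "form_bound b \<Longrightarrow> b' \<le> b \<Longrightarrow> form_bound b'"
  unfolding form_bound_def by (meson mult_right_mono order_trans zero_le_power2)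

text \<open>With X the inverse of D = T - \<mu> on the complement of the eigenspace and ||X|| <= 1/\<delta>, test the
  assumed form bound on f1 = (1 - \<epsilon> X) f: this multiplies the form of D + \<epsilon> by
  (1 - \<epsilon> X)^2 = 1 - 2 \<epsilon> X + ..., which turns D + \<epsilon> into D - \<epsilon> up to terms of order \<epsilon>^2/\<delta>.\<close>
lemma form_bound_flip:
  assumes gap: "\<And>f g. (f, g) \<in> T \<Longrightarrow> (\<And>e. e \<in> E \<Longrightarrow> f \<bullet> e = 0) \<Longrightarrow> \<delta> * norm f \<le> norm (g - \<mu> *\<^sub>R f)"
    and E: "E = eigenspace_rel T l" and "\<mu> \<noteq> l" and reg: "regular_at \<mu>" and \<delta>: "\<delta> > 0" and \<epsilon>: "\<epsilon> = \<delta> / 4"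
    and L: "\<And>f g. (f, g) \<in> T \<Longrightarrow> (\<mu> - \<epsilon>) * (norm f)\<^sup>2 \<le> g \<bullet> f + list_form L f"
  obtains L' where "\<And>f g. (f, g) \<in> T \<Longrightarrow> (\<And>e. e \<in> E \<Longrightarrow> f \<bullet> e = 0) \<Longrightarrow>
    (\<mu> + \<epsilon> / 2) * (norm f)\<^sup>2 \<le> g \<bullet> f + list_form L' f"
proof -
  have "\<exists>f. (f, u + \<mu> *\<^sub>R f) \<in> T" for u using surj_if_regular[OF reg] by blast
  then obtain X where X: "\<And>u. (X u, u + \<mu> *\<^sub>R X u) \<in> T" by metis
  have X_sym: "X u \<bullet> w = u \<bullet> X w" for u w
    using symm[OF X[of u] X[of w]] by (simp add: inner_add_left inner_add_right)
  have "(\<mu> + \<epsilon> / 2) * (norm f)\<^sup>2 \<le> g \<bullet> f + list_form (map (\<lambda>\<phi>. \<phi> - \<epsilon> *\<^sub>R X \<phi>) L) f"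
    if fg: "(f, g) \<in> T" and orth: "\<And>e. e \<in> E \<Longrightarrow> f \<bullet> e = 0" for f g
  proof -
    define h where "h = X f"
    have h: "(h, f + \<mu> *\<^sub>R h) \<in> T" unfolding h_def by (rule X)
    \<comment> \<open>The resolvent preserves the orthogonal complement of the eigenspace; dividing
      by \<mu> - l is where \<mu> \<noteq> l enters.\<close>
    have "h \<bullet> e = 0" if "e \<in> E" for e
    proof -
      have "(f + \<mu> *\<^sub>R h) \<bullet> e = l * (h \<bullet> e)" using eigenspace_orth[OF h] that E by blast
      then have "(\<mu> - l) * (h \<bullet> e) = 0" using orth[OF that] by (simp add: inner_add_left algebra_simps)
      then show ?thesis using \<open>\<mu> \<noteq> l\<close> by simp
    qed
    from gap[OF h this] have hf: "\<delta> * norm h \<le> norm f" by simp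
    define f1 where "f1 = f - \<epsilon> *\<^sub>R h"
    define g1 where "g1 = g - \<epsilon> *\<^sub>R (f + \<mu> *\<^sub>R h)"
    have "(f1, g1) \<in> T" unfolding f1_def g1_def by (intro diff_mem scale_mem fg h)
    from L[OF this] have 1: "(\<mu> - \<epsilon>) * (norm f1)\<^sup>2 \<le> g1 \<bullet> f1 + list_form L f1" .
    have q: "list_form L f1 = list_form (map (\<lambda>\<phi>. \<phi> - \<epsilon> *\<^sub>R X \<phi>) L) f"
      by (rule list_form_map_eq) (simp add: f1_def h_def inner_diff_left inner_diff_right X_sym)
    have gh: "g \<bullet> h = (norm f)\<^sup>2 + \<mu> * (f \<bullet> h)"
      using symm[OF fg h] by (simp add: inner_add_right power2_norm_eq_inner)
    have n1: "(norm f1)\<^sup>2 = (norm f)\<^sup>2 - 2 * \<epsilon> * (f \<bullet> h) + \<epsilon>\<^sup>2 * (norm h)\<^sup>2"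
      unfolding f1_def norm_diff_scaleR_square by (simp add: power2_norm_eq_inner[of h] power2_eq_square[of \<epsilon>])
    have g1f1: "g1 \<bullet> f1 = g \<bullet> f - 2 * \<epsilon> * (norm f)\<^sup>2 - 2 * \<epsilon> * \<mu> * (f \<bullet> h)
        + \<epsilon>\<^sup>2 * (f \<bullet> h) + \<epsilon>\<^sup>2 * \<mu> * (norm h)\<^sup>2"
    proof -
      have nn: "f \<bullet> f = (norm f)\<^sup>2" "h \<bullet> h = (norm h)\<^sup>2" by (simp_all add: power2_norm_eq_inner)
      have "g1 \<bullet> f1 = g \<bullet> f - \<epsilon> * (g \<bullet> h) - \<epsilon> * (f \<bullet> f + \<mu> * (f \<bullet> h)) + \<epsilon> * \<epsilon> * (f \<bullet> h + \<mu> * (h \<bullet> h))"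
        unfolding f1_def g1_def
        by (simp add: inner_diff_left inner_diff_right inner_add_left inner_commute[of h f] algebra_simps)
      then show ?thesis unfolding gh nn by (simp add: algebra_simps power2_eq_square[of \<epsilon>])
    qed
    have 2: "\<mu> * (norm f)\<^sup>2 + \<epsilon> * (norm f)\<^sup>2 + \<epsilon>\<^sup>2 * (f \<bullet> h) - \<epsilon> * (\<epsilon>\<^sup>2 * (norm h)\<^sup>2) \<le> g \<bullet> f + list_form L f1"
      using 1 unfolding n1 g1f1 by (simp add: algebra_simps power2_eq_square)
    \<comment> \<open>The choice \<epsilon> = \<delta> / 4 limits the two error terms to
      \<epsilon>/4 and \<epsilon>/16 of the squared norm, so more than \<epsilon>/2 of the gain
      \<epsilon> remains.\<close>
    have eh: "\<epsilon> * norm h \<le> norm f / 4" using hf by (simp add: \<epsilon>)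
    have \<epsilon>0: "\<epsilon> > 0" using \<delta> by (simp add: \<epsilon>)
    have "\<epsilon> * \<bar>f \<bullet> h\<bar> \<le> norm f * (\<epsilon> * norm h)"
      using mult_left_mono[OF Cauchy_Schwarz_ineq2[of f h], of \<epsilon>] \<epsilon>0 by (simp add: algebra_simps)
    also have "\<dots> \<le> norm f * (norm f / 4)" using eh by (intro mult_left_mono) auto
    finally have "\<bar>\<epsilon> * (f \<bullet> h)\<bar> \<le> (norm f)\<^sup>2 / 4" using \<epsilon>0 by (simp add: abs_mult power2_eq_square)
    then have "\<epsilon> * - ((norm f)\<^sup>2 / 4) \<le> \<epsilon> * (\<epsilon> * (f \<bullet> h))" using \<epsilon>0 by (intro mult_left_mono) auto
    then have 3: "- (\<epsilon> * (norm f)\<^sup>2) / 4 \<le> \<epsilon>\<^sup>2 * (f \<bullet> h)" by (simp add: power2_eq_square algebra_simps)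
    have "(\<epsilon> * norm h)\<^sup>2 \<le> (norm f / 4)\<^sup>2" using eh \<epsilon>0 by (intro power_mono) auto
    then have "\<epsilon> * (\<epsilon>\<^sup>2 * (norm h)\<^sup>2) \<le> \<epsilon> * ((norm f)\<^sup>2 / 16)"
      using \<epsilon>0 by (intro mult_left_mono) (auto simp: power_mult_distrib power_divide)
    then have 4: "\<epsilon> * (\<epsilon>\<^sup>2 * (norm h)\<^sup>2) \<le> \<epsilon> * (norm f)\<^sup>2 / 16" by simp
    have 5: "0 \<le> \<epsilon> * (norm f)\<^sup>2" using \<epsilon>0 by simp
    have "(\<mu> + \<epsilon> / 2) * (norm f)\<^sup>2 = \<mu> * (norm f)\<^sup>2 + \<epsilon> * (norm f)\<^sup>2 / 2" by (simp add: algebra_simps)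
    then show ?thesis using 2 3 4 5 q by linarith
  qed
  then show ?thesis using that by blast
qed

text \<open>Off the eigenspace the bound is raised by \<open>form_bound_flip\<close>; the
  eigencomponent is finite-dimensional, so its squared norm is itself of the form
  \<open>list_form\<close> and can be added to the correction.\<close>

lemma form_bound_raise:
  assumes "l \<notin> sa_ess_spectrum T"
  obtains \<epsilon> where "\<epsilon> > 0" "form_bound (l - \<epsilon>) \<Longrightarrow> form_bound (l + \<epsilon>)"
proof -
  obtain B \<delta> where B: "finite B" "eigenspace_rel T l \<subseteq> span B" and \<delta>: "\<delta> > 0" "gap_at l \<delta>"
    using not_ess_spectrumE[OF assms] by metis
  define E where "E = eigenspace_rel T l"
  obtain LE where LE: "\<And>e f. e \<in> E \<Longrightarrow> (\<And>x. x \<in> E \<Longrightarrow> f \<bullet> x = 0) \<Longrightarrow> (norm e)\<^sup>2 = list_form LE (e + f)"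
    using finite_dim_norm_bound[OF subspace_eigenspace closed_eigenspace B] unfolding E_def by metis
  define \<epsilon> where "\<epsilon> = \<delta> / 8"
  \<comment> \<open>l may be an eigenvalue, so the flip is made at a nearby regular point. The gap
    there is still \<delta>/2, four times \<epsilon>, and the shift \<epsilon>/8 is small enough
    that \<mu> - \<epsilon> \<le> l - \<epsilon>/4 and \<mu> + \<epsilon>/2 \<ge> l +
    \<epsilon>/4.\<close>
  define \<mu> where "\<mu> = l + \<epsilon> / 8"
  have \<epsilon>: "\<epsilon> > 0" "\<epsilon> = \<delta> / 2 / 4" using \<delta> by (auto simp: \<epsilon>_def)
  have reg: "regular_at \<mu>"
    by (rule regular_near_gap[OF \<delta>(2)]) (use \<delta>(1) in \<open>auto simp: \<mu>_def \<epsilon>_def\<close>)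
  have gap: "\<delta> / 2 * norm f \<le> norm (g - \<mu> *\<^sub>R f)"
    if "(f, g) \<in> T" "\<And>e. e \<in> E \<Longrightarrow> f \<bullet> e = 0" for f g
  proof -
    have "\<delta> * norm f \<le> norm (g - l *\<^sub>R f)" using \<delta>(2) that by (simp add: gap_at_def E_def)
    also have "g - l *\<^sub>R f = (g - \<mu> *\<^sub>R f) + (\<epsilon> / 8) *\<^sub>R f" by (simp add: \<mu>_def algebra_simps)
    also have "norm \<dots> \<le> norm (g - \<mu> *\<^sub>R f) + \<epsilon> / 8 * norm f"
      using norm_triangle_ineq[of "g - \<mu> *\<^sub>R f" "(\<epsilon> / 8) *\<^sub>R f"] \<epsilon>(1) by simp
    also have "\<epsilon> / 8 * norm f \<le> \<delta> / 2 * norm f"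
      using \<delta>(1) by (intro mult_right_mono) (auto simp: \<epsilon>_def)
    finally show ?thesis by (simp add: algebra_simps)
  qed
  have "form_bound (l + \<epsilon> / 4)" if "form_bound (l - \<epsilon> / 4)"
  proof -
    have "form_bound (\<mu> - \<epsilon>)" using that by (rule form_bound_mono) (use \<epsilon>(1) in \<open>simp add: \<mu>_def\<close>)
    then obtain L where L: "\<And>f g. (f, g) \<in> T \<Longrightarrow> (\<mu> - \<epsilon>) * (norm f)\<^sup>2 \<le> g \<bullet> f + list_form L f"
      unfolding form_bound_def by blast
    obtain L' where L': "\<And>f g. (f, g) \<in> T \<Longrightarrow> (\<And>e. e \<in> E \<Longrightarrow> f \<bullet> e = 0) \<Longrightarrow>
        (\<mu> + \<epsilon> / 2) * (norm f)\<^sup>2 \<le> g \<bullet> f + list_form L' f"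
      by (rule form_bound_flip[OF gap E_def _ reg _ \<epsilon>(2) L]) (use \<epsilon>(1) \<delta>(1) in \<open>auto simp: \<mu>_def\<close>)
    obtain C where C: "C \<ge> 0" "\<And>f. list_form L' f \<le> C * (norm f)\<^sup>2" using list_form_le[of L'] by blast
    \<comment> \<open>The part \<epsilon>/4 lifts the eigencomponent from l to l + \<epsilon>/4; the
      part 2C pays for evaluating L' at f instead of f'.\<close>
    define c where "c = \<epsilon> / 4 + 2 * C"
    have c: "c \<ge> 0" using \<epsilon>(1) C(1) by (simp add: c_def)
    define L2 where "L2 = map (scaleR (sqrt 2)) L' @ map (scaleR (sqrt c)) LE"
    have "(l + \<epsilon> / 4) * (norm f)\<^sup>2 \<le> g \<bullet> f + list_form L2 f" if fg: "(f, g) \<in> T" for f g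
    proof -
      obtain e f' where e: "e \<in> E" "f = e + f'" and f': "(f', g - l *\<^sub>R e) \<in> T"
        and orth: "\<And>x. x \<in> E \<Longrightarrow> f' \<bullet> x = 0"
        using eigenspace_decomp[OF fg] unfolding E_def by metis
      define g' where "g' = g - l *\<^sub>R e"
      have g'e: "g' \<bullet> e = 0" using eigenspace_orth[OF f'] e(1) orth[OF e(1)] by (simp add: g'_def E_def)
      have f'e: "f' \<bullet> e = 0" "e \<bullet> f' = 0" using orth[OF e(1)] by (simp_all add: inner_commute)
      have g: "g = l *\<^sub>R e + g'" by (simp add: g'_def)
      have gf: "g \<bullet> f = l * (norm e)\<^sup>2 + g' \<bullet> f'"
        unfolding g e(2) by (simp add: inner_add_left inner_add_right g'e f'e power2_norm_eq_inner)
      have nf: "(norm f)\<^sup>2 = (norm e)\<^sup>2 + (norm f')\<^sup>2"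
        unfolding e(2) using f'e by (intro norm_add_Pythagorean) (simp add: orthogonal_def)
      have "(\<mu> + \<epsilon> / 2) * (norm f')\<^sup>2 \<le> g' \<bullet> f' + list_form L' f'"
        using L'[OF f' orth] by (simp add: g'_def)
      moreover have "(l + \<epsilon> / 4) * (norm f')\<^sup>2 \<le> (\<mu> + \<epsilon> / 2) * (norm f')\<^sup>2"
        using \<epsilon>(1) by (intro mult_right_mono) (auto simp: \<mu>_def)
      moreover have "list_form L' f' \<le> 2 * list_form L' f + 2 * list_form L' e"
        using list_form_diff_le[of L' f e] by (simp add: e(2))
      moreover have "list_form L' e \<le> C * (norm e)\<^sup>2" by (rule C(2))
      moreover have "list_form L2 f = 2 * list_form L' f + c * (norm e)\<^sup>2"
        using LE[OF e(1) orth] c by (simp add: L2_def list_form_map_scaleR e(2))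
      moreover have "c * (norm e)\<^sup>2 = \<epsilon> / 4 * (norm e)\<^sup>2 + 2 * (C * (norm e)\<^sup>2)" by (simp add: c_def algebra_simps)
      ultimately show ?thesis unfolding gf nf by (simp add: distrib_left distrib_right)
    qed
    then show ?thesis unfolding form_bound_def by blast
  qed
  then show ?thesis using that[of "\<epsilon> / 4"] \<epsilon>(1) by simp
qed

section \<open>The bottom of the essential spectrum as a supremum of form bounds\<close>

lemma form_bound_le_ess_spectrum:
  assumes "form_bound b" "l \<in> sa_ess_spectrum T"
  shows "b \<le> l"
proof (rule field_le_epsilon)
  fix e :: real assume e: "e > 0"
  obtain L where L: "\<And>f g. (f, g) \<in> T \<Longrightarrow> b * (norm f)\<^sup>2 \<le> g \<bullet> f + list_form L f"
    using assms(1) unfolding form_bound_def by blast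
  \<comment> \<open>(e/2)^2 makes the residual of the approximate eigenvector at most e/2 times its
    norm; e/2 does the same for the finite-rank term.\<close>
  define \<epsilon> where "\<epsilon> = min (e / 2) ((e / 2)\<^sup>2)"
  have "\<epsilon> > 0" using e by (simp add: \<epsilon>_def)
  then obtain f g where fg: "(f, g) \<in> T" "(norm (g - l *\<^sub>R f))\<^sup>2 + list_form L f < \<epsilon> * (norm f)\<^sup>2"
    using ess_spectrum_approx[OF assms(2)] by metis
  have "(norm (g - l *\<^sub>R f))\<^sup>2 \<le> \<epsilon> * (norm f)\<^sup>2" using fg(2) list_form_nonneg[of L f] by linarith
  also have "\<dots> \<le> (e / 2 * norm f)\<^sup>2"
    unfolding power_mult_distrib by (intro mult_right_mono) (auto simp: \<epsilon>_def)
  finally have 1: "norm (g - l *\<^sub>R f) \<le> e / 2 * norm f" by (rule power2_le_imp_le) (use e in simp)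
  have "g \<bullet> f = l * (norm f)\<^sup>2 + (g - l *\<^sub>R f) \<bullet> f" by (simp add: inner_diff_left power2_norm_eq_inner)
  also have "(g - l *\<^sub>R f) \<bullet> f \<le> norm (g - l *\<^sub>R f) * norm f" by (rule norm_cauchy_schwarz)
  also have "\<dots> \<le> e / 2 * (norm f)\<^sup>2"
    using mult_right_mono[OF 1 norm_ge_zero[of f]] by (simp add: power2_eq_square mult.assoc)
  finally have "g \<bullet> f \<le> l * (norm f)\<^sup>2 + e / 2 * (norm f)\<^sup>2" by simp
  moreover have "list_form L f \<le> e / 2 * (norm f)\<^sup>2"
  proof -
    have "list_form L f \<le> \<epsilon> * (norm f)\<^sup>2" using fg(2) zero_le_power2[of "norm (g - l *\<^sub>R f)"] by linarith
    also have "\<dots> \<le> e / 2 * (norm f)\<^sup>2" by (intro mult_right_mono) (auto simp: \<epsilon>_def)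
    finally show ?thesis .
  qed
  ultimately have "b * (norm f)\<^sup>2 \<le> (l + e) * (norm f)\<^sup>2" using L[OF fg(1)] by (simp add: distrib_right)
  moreover have "(norm f)\<^sup>2 > 0"
  proof -
    have "\<epsilon> * (norm f)\<^sup>2 > 0"
      using fg(2) list_form_nonneg[of L f] zero_le_power2[of "norm (g - l *\<^sub>R f)"] by linarith
    then show ?thesis using \<open>\<epsilon> > 0\<close> by (simp add: zero_less_mult_iff)
  qed
  ultimately show "b \<le> l + e" by (rule mult_right_le_imp_le)
qed

text \<open>Otherwise the supremum of all admissible b is at most a, hence outside the essential
  spectrum, and \<open>form_bound_raise\<close> pushes beyond it. The given m makes this supremum
  one over a nonempty set.\<close>

lemma form_bound_above:
  assumes "form_bound m" and noess: "\<And>l. l \<le> a \<Longrightarrow> l \<notin> sa_ess_spectrum T"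
  shows "\<exists>b>a. form_bound b"
proof (rule ccontr)
  assume "\<not> ?thesis"
  then have le: "b \<le> a" if "form_bound b" for b using that by force
  define \<nu> where "\<nu> = Sup {b. form_bound b}"
  have bdd: "bdd_above {b. form_bound b}" using le by (intro bdd_aboveI[of _ a]) auto
  have ne: "{b. form_bound b} \<noteq> {}" using assms(1) by blast
  have "\<nu> \<le> a" unfolding \<nu>_def using le by (intro cSup_least[OF ne]) auto
  then obtain \<epsilon> where \<epsilon>: "\<epsilon> > 0" "form_bound (\<nu> - \<epsilon>) \<Longrightarrow> form_bound (\<nu> + \<epsilon>)"
    using form_bound_raise[OF noess] by metis
  obtain b where "form_bound b" "\<nu> - \<epsilon> < b"
    using less_cSupD[OF ne, of "\<nu> - \<epsilon>"] \<epsilon>(1) by (auto simp: \<nu>_def)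
  then have "form_bound (\<nu> + \<epsilon>)" using \<epsilon>(2) form_bound_mono by (meson less_imp_le)
  then have "\<nu> + \<epsilon> \<le> Sup {b. form_bound b}" by (intro cSup_upper[OF _ bdd]) simp
  then have "\<nu> + \<epsilon> \<le> \<nu>" by (simp add: \<nu>_def)
  with \<epsilon>(1) show False by simp
qed

lemma inf_ess_greater_iff:
  assumes "form_bound m"
  shows "inf_ess T > ereal a \<longleftrightarrow> (\<exists>b>a. form_bound b)"
proof
  assume inf: "inf_ess T > ereal a"
  have "l \<notin> sa_ess_spectrum T" if "l \<le> a" for l
  proof
    assume "l \<in> sa_ess_spectrum T"
    then have "inf_ess T \<le> ereal l" unfolding inf_ess_def by (intro Inf_lower) auto
    also have "\<dots> \<le> ereal a" using that by simp
    finally show False using inf by simp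
  qed
  then show "\<exists>b>a. form_bound b" by (rule form_bound_above[OF assms])
next
  assume "\<exists>b>a. form_bound b"
  then obtain b where b: "b > a" "form_bound b" by blast
  have "ereal b \<le> inf_ess T"
    unfolding inf_ess_def using form_bound_le_ess_spectrum[OF b(2)] by (intro Inf_greatest) auto
  then show "inf_ess T > ereal a" using b(1) by (meson ereal_less(3) less_ereal.simps(1) order_less_le_trans)
qed

lemma inf_ess_greaterI:
  assumes "form_bound m" "\<And>l. l \<le> a \<Longrightarrow> l \<notin> sa_ess_spectrum T"
  shows "inf_ess T > ereal a"
  using form_bound_above[OF assms] inf_ess_greater_iff[OF assms(1)] by blast

lemma inf_ess_ge_iff:
  assumes "form_bound m"
  shows "inf_ess T \<ge> ereal a \<longleftrightarrow> (\<forall>a'<a. \<exists>b>a'. form_bound b)"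
proof -
  have "inf_ess T \<ge> ereal a \<longleftrightarrow> (\<forall>a'<a. inf_ess T > ereal a')"
  proof
    assume all: "\<forall>a'<a. inf_ess T > ereal a'"
    show "inf_ess T \<ge> ereal a"
    proof (rule ccontr)
      assume "\<not> ?thesis"
      then obtain a' where "inf_ess T < ereal a'" "ereal a' < ereal a"
        using ereal_dense2[of "inf_ess T" "ereal a"] not_le by blast
      with all show False by (meson less_ereal.simps(1) not_less_iff_gr_or_eq)
    qed
  qed (meson less_ereal.simps(1) order_less_le_trans)
  then show ?thesis using inf_ess_greater_iff[OF assms] by simp
qed

end

section \<open>Transfer of form bounds through Krein's formula\<close>

lemma (in sa_relation) ess_spectrum_approx_unit:
  assumes "l \<in> sa_ess_spectrum T" "s > 0"
  obtains f g where "(f, g) \<in> T" "norm f = 1" "norm (g - l *\<^sub>R f) < s" "list_form L f < s\<^sup>2"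
proof -
  obtain f g where fg: "(f, g) \<in> T" "(norm (g - l *\<^sub>R f))\<^sup>2 + list_form L f < s\<^sup>2 * (norm f)\<^sup>2"
    using ess_spectrum_approx[OF assms(1), of "s\<^sup>2" L] assms(2) by auto
  have nf: "norm f > 0"
  proof (rule ccontr)
    assume "\<not> norm f > 0"
    then have "(norm (g - l *\<^sub>R f))\<^sup>2 + list_form L f < 0" using fg(2) by simp
    then show False using list_form_nonneg[of L f] zero_le_power2[of "norm (g - l *\<^sub>R f)"] by linarith
  qed
  define t where "t = 1 / norm f"
  have t: "t > 0" "t\<^sup>2 * (norm f)\<^sup>2 = 1" using nf by (auto simp: t_def power_divide)
  have "t *\<^sub>R g - l *\<^sub>R t *\<^sub>R f = t *\<^sub>R (g - l *\<^sub>R f)" by (simp add: algebra_simps)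
  then have "(norm (t *\<^sub>R g - l *\<^sub>R t *\<^sub>R f))\<^sup>2 + list_form L (t *\<^sub>R f)
      = t\<^sup>2 * ((norm (g - l *\<^sub>R f))\<^sup>2 + list_form L f)"
    by (simp add: list_form_scaleR power_mult_distrib distrib_left)
  also have "\<dots> < t\<^sup>2 * (s\<^sup>2 * (norm f)\<^sup>2)" using fg(2) t(1) by (intro mult_strict_left_mono) auto
  also have "\<dots> = s\<^sup>2" using t(2) by (simp add: mult.left_commute)
  finally have *: "(norm (t *\<^sub>R g - l *\<^sub>R t *\<^sub>R f))\<^sup>2 + list_form L (t *\<^sub>R f) < s\<^sup>2" .
  have "(norm (t *\<^sub>R g - l *\<^sub>R t *\<^sub>R f))\<^sup>2 < s\<^sup>2" using * list_form_nonneg[of L "t *\<^sub>R f"] by linarith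
  then have "norm (t *\<^sub>R g - l *\<^sub>R t *\<^sub>R f) < s" using assms(2) by (simp add: power_less_imp_less_base)
  moreover have "list_form L (t *\<^sub>R f) < s\<^sup>2"
    using * zero_le_power2[of "norm (t *\<^sub>R g - l *\<^sub>R t *\<^sub>R f)"] by linarith
  moreover have "norm (t *\<^sub>R f) = 1" using nf by (simp add: t_def)
  ultimately show ?thesis using that scale_mem[OF fg(1)] by blast
qed

lemma list_form_split_le:
  assumes "\<And>\<phi>. \<phi> \<in> set L \<Longrightarrow> h \<bullet> \<phi> = f \<bullet> p \<phi> - d \<bullet> q \<phi>"
  shows "list_form L h \<le> 2 * list_form (map p L) f + 2 * list_form (map q L) d"
  using assms
proof (induction L)
  case (Cons \<phi> L)
  have "(h \<bullet> \<phi>)\<^sup>2 \<le> 2 * (f \<bullet> p \<phi>)\<^sup>2 + 2 * (d \<bullet> q \<phi>)\<^sup>2"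
    using square_diff_le Cons.prems[of \<phi>] by simp
  then show ?case using Cons by simp
qed simp

text \<open>S is the extension, T = \<Theta> - M(0), B the inverse of the Friedrichs extension, \<gamma> the \<gamma>-field
  at 0 and \<gamma>s its adjoint: the first assumption is Krein's formula for the inverse of S, and
  the last one expresses that the form domain of the Friedrichs extension meets ker A* only in 0.\<close>
locale krein_pair = S: sa_relation S + T: sa_relation T
  for S :: "('a::{real_inner, complete_space} \<times> 'a) set"
    and T :: "('b::{real_inner, complete_space} \<times> 'b) set" +
  fixes B :: "'a \<Rightarrow> 'a" and \<gamma> :: "'b \<Rightarrow> 'a" and \<gamma>s :: "'a \<Rightarrow> 'b" and a0 :: real
  assumes S_iff: "(f, g) \<in> S \<longleftrightarrow> (\<exists>h. f = B g + \<gamma> h \<and> (h, \<gamma>s g) \<in> T)"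
    and B_linear: "linear B" and B_sym: "B u \<bullet> v = u \<bullet> B v"
    and a0: "a0 > 0" and B_pos: "a0 * (norm (B u))\<^sup>2 \<le> B u \<bullet> u"
    and adj: "\<gamma> h \<bullet> g = h \<bullet> \<gamma>s g"
    and approx: "e > 0 \<Longrightarrow> \<exists>g. \<gamma>s g = k \<and> B g \<bullet> g < e"
begin

sublocale B: linear B by (rule B_linear)

lemma gamma_scale: "\<gamma> (c *\<^sub>R h) = c *\<^sub>R \<gamma> h"
proof -
  have "(\<gamma> (c *\<^sub>R h) - c *\<^sub>R \<gamma> h) \<bullet> g = 0" for g by (simp add: inner_diff_left adj)
  then show ?thesis by (metis inner_eq_zero_iff right_minus_eq)
qed

text \<open>Hellinger-Toeplitz argument: the adjoint is defined everywhere, so \<gamma> maps the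
  unit ball to a weakly bounded set.\<close>

lemma gamma_upper: obtains C where "C > 0" "\<And>h. norm (\<gamma> h) \<le> C * norm h"
proof -
  have "\<exists>C. \<forall>\<phi>\<in>\<gamma> ` {h. norm h \<le> 1}. \<bar>\<phi> \<bullet> g\<bar> \<le> C" for g
  proof (intro exI ballI)
    fix \<phi> assume "\<phi> \<in> \<gamma> ` {h. norm h \<le> 1}"
    then obtain h where h: "\<phi> = \<gamma> h" "norm h \<le> 1" by blast
    have "\<bar>\<phi> \<bullet> g\<bar> \<le> norm h * norm (\<gamma>s g)" unfolding h(1) adj by (rule Cauchy_Schwarz_ineq2)
    also have "\<dots> \<le> 1 * norm (\<gamma>s g)" using h(2) by (intro mult_right_mono) auto
    finally show "\<bar>\<phi> \<bullet> g\<bar> \<le> norm (\<gamma>s g)" by simp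
  qed
  then obtain C where C: "C > 0" "\<And>\<phi>. \<phi> \<in> \<gamma> ` {h. norm h \<le> 1} \<Longrightarrow> norm \<phi> \<le> C"
    using weakly_bounded_imp_bounded[of "\<gamma> ` {h. norm h \<le> 1}"] by blast
  have "norm (\<gamma> h) \<le> C * norm h" for h
  proof (cases "h = 0")
    case True
    then show ?thesis using gamma_scale[of 0 0] by simp
  next
    case False
    have "norm (\<gamma> ((1 / norm h) *\<^sub>R h)) \<le> C" using False by (intro C(2) imageI) simp
    then show ?thesis using False by (simp add: gamma_scale field_simps)
  qed
  with C(1) show ?thesis using that by blast
qed

text \<open>Dual to the upper bound: as \<gamma>s is onto, every k is some \<gamma>s g, so the h
  with \<gamma> h in the unit ball form a weakly bounded set.\<close>

lemma gamma_lower: obtains c where "c > 0" "\<And>h. c * norm h \<le> norm (\<gamma> h)"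
proof -
  have "\<exists>C. \<forall>h\<in>{h. norm (\<gamma> h) \<le> 1}. \<bar>h \<bullet> k\<bar> \<le> C" for k
  proof -
    obtain g where g: "\<gamma>s g = k" using approx[of 1 k] by auto
    have "\<bar>h \<bullet> k\<bar> \<le> norm g" if "norm (\<gamma> h) \<le> 1" for h
    proof -
      have "\<bar>h \<bullet> k\<bar> \<le> norm (\<gamma> h) * norm g" unfolding g[symmetric] adj[symmetric] by (rule Cauchy_Schwarz_ineq2)
      also have "\<dots> \<le> 1 * norm g" using that by (intro mult_right_mono) auto
      finally show ?thesis by simp
    qed
    then show ?thesis by blast
  qed
  then obtain C where C: "C > 0" "\<And>h. h \<in> {h. norm (\<gamma> h) \<le> 1} \<Longrightarrow> norm h \<le> C"
    using weakly_bounded_imp_bounded[of "{h. norm (\<gamma> h) \<le> 1}"] by blast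
  have "norm h \<le> C * norm (\<gamma> h)" for h
  proof (cases "\<gamma> h = 0")
    case True
    have "h = 0"
    proof (rule ccontr)
      assume "h \<noteq> 0"
      \<comment> \<open>A nonzero kernel vector could be rescaled to norm C + 1 without leaving the
        set bounded by C.\<close>
      have "norm (((C + 1) / norm h) *\<^sub>R h) \<le> C" by (rule C(2)) (simp add: gamma_scale True)
      then show False using \<open>h \<noteq> 0\<close> C(1) by simp
    qed
    then show ?thesis using C(1) by simp
  next
    case False
    have "norm ((1 / norm (\<gamma> h)) *\<^sub>R h) \<le> C" using False by (intro C(2)) (simp add: gamma_scale)
    then show ?thesis using False by (simp add: field_simps)
  qed
  then have "1 / C * norm h \<le> norm (\<gamma> h)" for h using C(1) by (simp add: field_simps)
  then show ?thesis using that[of "1 / C"] C(1) by simp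
qed

section \<open>Energy splitting and the transfer of form bounds\<close>

lemma norm_B_le: "norm (B u) \<le> norm u / a0"
proof (cases "B u = 0")
  case False
  have "a0 * (norm (B u))\<^sup>2 \<le> norm (B u) * norm u"
    using B_pos[of u] norm_cauchy_schwarz[of "B u" u] by linarith
  then have "norm (B u) * (a0 * norm (B u)) \<le> norm (B u) * norm u" by (simp add: power2_eq_square mult_ac)
  then have "a0 * norm (B u) \<le> norm u" using False by simp
  then show ?thesis using a0 by (simp add: field_simps)
qed (use a0 in simp)

lemma B_nonneg: "0 \<le> B u \<bullet> u"
  using B_pos[of u] a0 by (smt (verit) mult_nonneg_nonneg zero_le_power2)

text \<open>The form of S splits into the nonnegative Friedrichs energy of B g and, when (h,
  \<gamma>s g) is in T, the form of T at h.\<close>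

lemma form_S:
  assumes "f = B g + \<gamma> h"
  shows "g \<bullet> f = B g \<bullet> g + \<gamma>s g \<bullet> h"
  using adj[of h g] by (simp add: assms inner_add_right inner_commute)

text \<open>Every g with \<gamma>s g = k lifts (h, k) to (B g + \<gamma> h, g) in S. When the
  energies of B g tend to 0, so do their norms because a0 > 0; the lifts converge to \<gamma> h,
  their form values to that of T, and the bound survives in the limit.\<close>

lemma form_bound_transfer:
  assumes "S.form_bound b"
  obtains L where "\<And>h k. (h, k) \<in> T \<Longrightarrow> b * (norm (\<gamma> h))\<^sup>2 \<le> k \<bullet> h + list_form L h"
proof -
  obtain L where L: "\<And>f g. (f, g) \<in> S \<Longrightarrow> b * (norm f)\<^sup>2 \<le> g \<bullet> f + list_form L f"
    using assms unfolding S.form_bound_def by blast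
  have "b * (norm (\<gamma> h))\<^sup>2 \<le> k \<bullet> h + list_form (map \<gamma>s L) h" if hk: "(h, k) \<in> T" for h k
  proof -
    have "\<exists>g. \<gamma>s g = k \<and> B g \<bullet> g < 1 / real (Suc n)" for n by (rule approx) simp
    then obtain g where g: "\<And>n. \<gamma>s (g n) = k" "\<And>n. B (g n) \<bullet> g n < 1 / real (Suc n)" by metis
    have lim0: "(\<lambda>n. 1 / real (Suc n)) \<longlonglongrightarrow> 0" by (rule LIMSEQ_Suc[OF lim_1_over_n])
    have Bg: "(\<lambda>n. B (g n) \<bullet> g n) \<longlonglongrightarrow> 0"
    proof (rule tendsto_sandwich[OF _ _ tendsto_const lim0])
      show "\<forall>\<^sub>F n in sequentially. 0 \<le> B (g n) \<bullet> g n" by (simp add: B_nonneg)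
      show "\<forall>\<^sub>F n in sequentially. B (g n) \<bullet> g n \<le> 1 / real (Suc n)"
        by (intro always_eventually allI less_imp_le g(2))
    qed
    have "(\<lambda>n. (norm (B (g n)))\<^sup>2) \<longlonglongrightarrow> 0"
    proof (rule tendsto_sandwich[OF _ _ tendsto_const])
      show "(\<lambda>n. (B (g n) \<bullet> g n) / a0) \<longlonglongrightarrow> 0" using tendsto_divide[OF Bg tendsto_const[of a0]] a0 by simp
      show "\<forall>\<^sub>F n in sequentially. (norm (B (g n)))\<^sup>2 \<le> (B (g n) \<bullet> g n) / a0"
        using B_pos a0 by (simp add: field_simps)
    qed simp
    then have "(\<lambda>n. norm (B (g n))) \<longlonglongrightarrow> 0" using tendsto_real_sqrt by fastforce
    then have B0: "(\<lambda>n. B (g n)) \<longlonglongrightarrow> 0" by (rule tendsto_norm_zero_cancel)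
    define f where "f n = B (g n) + \<gamma> h" for n
    have f: "f \<longlonglongrightarrow> \<gamma> h" unfolding f_def using tendsto_add[OF B0 tendsto_const] by simp
    have le: "b * (norm (f n))\<^sup>2 \<le> B (g n) \<bullet> g n + k \<bullet> h + list_form L (f n)" for n
    proof -
      have "(f n, g n) \<in> S" unfolding S_iff f_def using hk g(1) by auto
      from L[OF this] show ?thesis using form_S[of "f n" "g n" h] g(1) by (simp add: f_def)
    qed
    have "(\<lambda>n. b * (norm (f n))\<^sup>2) \<longlonglongrightarrow> b * (norm (\<gamma> h))\<^sup>2"
      by (intro tendsto_mult tendsto_power tendsto_norm tendsto_const f)
    moreover have "(\<lambda>n. B (g n) \<bullet> g n + k \<bullet> h + list_form L (f n)) \<longlonglongrightarrow> 0 + k \<bullet> h + list_form L (\<gamma> h)"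
      by (intro tendsto_add tendsto_const Bg tendsto_list_form f)
    ultimately have "b * (norm (\<gamma> h))\<^sup>2 \<le> 0 + k \<bullet> h + list_form L (\<gamma> h)"
      using le by (intro LIMSEQ_le) auto
    also have "list_form L (\<gamma> h) = list_form (map \<gamma>s L) h"
      by (rule list_form_map_eq) (rule adj)
    finally show ?thesis by simp
  qed
  then show ?thesis using that by blast
qed

text \<open>Replacing \<gamma> h by h costs the lower constant of \<gamma> for b \<ge> 0 and the
  upper one for b \<le> 0, hence two versions.\<close>

lemma form_bound_transfer_nonneg:
  assumes "S.form_bound b" "b \<ge> 0" and c: "c > 0" "\<And>h. c * norm h \<le> norm (\<gamma> h)"
  shows "T.form_bound (b * c\<^sup>2)"
proof -
  obtain L where L: "\<And>h k. (h, k) \<in> T \<Longrightarrow> b * (norm (\<gamma> h))\<^sup>2 \<le> k \<bullet> h + list_form L h"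
    using form_bound_transfer[OF assms(1)] by metis
  have "b * c\<^sup>2 * (norm h)\<^sup>2 \<le> k \<bullet> h + list_form L h" if "(h, k) \<in> T" for h k
  proof -
    have "b * (c * norm h)\<^sup>2 \<le> b * (norm (\<gamma> h))\<^sup>2"
      using c assms(2) by (intro mult_left_mono power_mono) auto
    then show ?thesis using L[OF that] by (simp add: power_mult_distrib)
  qed
  then show ?thesis unfolding T.form_bound_def by blast
qed

lemma form_bound_transfer_nonpos:
  assumes "S.form_bound b" "b \<le> 0" and C: "\<And>h. norm (\<gamma> h) \<le> C * norm h"
  shows "T.form_bound (b * C\<^sup>2)"
proof -
  obtain L where L: "\<And>h k. (h, k) \<in> T \<Longrightarrow> b * (norm (\<gamma> h))\<^sup>2 \<le> k \<bullet> h + list_form L h"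
    using form_bound_transfer[OF assms(1)] by metis
  have "b * C\<^sup>2 * (norm h)\<^sup>2 \<le> k \<bullet> h + list_form L h" if "(h, k) \<in> T" for h k
  proof -
    have "b * (C * norm h)\<^sup>2 \<le> b * (norm (\<gamma> h))\<^sup>2"
      using C[of h] assms(2) by (intro mult_left_mono_neg power_mono) auto
    then show ?thesis using L[OF that] by (simp add: power_mult_distrib)
  qed
  then show ?thesis unfolding T.form_bound_def by blast
qed

text \<open>For a unit approximate eigenvector f with g = l f + d, the vector \<gamma> h = f - l B f
  - B d stays away from 0 since - l B is nonnegative and d is small, so h is bounded on both sides.
  Dropping the energy of B g leaves a form value of T at h only slightly above l, and the norm
  bounds on h turn this into information on b of either sign.\<close>

lemma ess_spectrum_S_approx:
  assumes l: "l \<in> sa_ess_spectrum S" "l \<le> 0" and b: "T.form_bound b"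
    and C: "C > 0" "\<And>h. norm (\<gamma> h) \<le> C * norm h"
    and c: "c > 0" "\<And>h. c * norm h \<le> norm (\<gamma> h)" and e: "e > 0"
  shows "\<exists>h::'b. b * (norm h)\<^sup>2 \<le> l + e \<and> 1 / (2 * C) \<le> norm h \<and> norm h \<le> (1 + (\<bar>l\<bar> + 1) / a0) / c"
proof -
  obtain L where L: "\<And>h k. (h, k) \<in> T \<Longrightarrow> b * (norm h)\<^sup>2 \<le> k \<bullet> h + list_form L h"
    using b unfolding T.form_bound_def by blast
  have "\<exists>g. \<gamma>s g = \<phi>" for \<phi> using approx[of 1 \<phi>] by auto
  then obtain \<psi> where \<psi>: "\<And>\<phi>. \<gamma>s (\<psi> \<phi>) = \<phi>" by metis
  \<comment> \<open>h \<bullet> \<phi> equals \<gamma> h \<bullet> \<psi> \<phi>; moving 1 - l B and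
    B to the other side of the inner product turns it into a functional p of f minus a functional q
    of d. The list of all \<open>p \<phi>\<close> is what f has to nearly annihilate.\<close>
  define p where "p \<phi> = \<psi> \<phi> - l *\<^sub>R B (\<psi> \<phi>)" for \<phi>
  define q where "q \<phi> = B (\<psi> \<phi>)" for \<phi>
  obtain K where K: "K \<ge> 0" "\<And>f. list_form (map q L) f \<le> K * (norm f)\<^sup>2"
    using list_form_le[of "map q L"] by blast
  \<comment> \<open>a0/2 keeps B d below 1/2 in norm, 1 gives s^2 \<le> s, and 3 + 2K collects s
    from d \<bullet> f and (2 + 2K) s from the finite-rank terms.\<close>
  define s where "s = min (min 1 (a0 / 2)) (e / (3 + 2 * K))"
  have "s \<le> min 1 (a0 / 2)" unfolding s_def by (rule min.cobounded1)
  moreover have "s \<le> e / (3 + 2 * K)" unfolding s_def by (rule min.cobounded2)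
  moreover have "s > 0" using a0 e K(1) by (simp add: s_def)
  ultimately have s: "s > 0" "s \<le> 1" "s \<le> a0 / 2" "s \<le> e / (3 + 2 * K)" by (simp_all only: min.bounded_iff)
  have se: "s * (3 + 2 * K) \<le> e" using s(4) K(1) by (simp add: field_simps)
  obtain f g where fg: "(f, g) \<in> S" "norm f = 1" "norm (g - l *\<^sub>R f) < s" "list_form (map p L) f < s\<^sup>2"
    using S.ess_spectrum_approx_unit[OF l(1) s(1)] by metis
  define d where "d = g - l *\<^sub>R f"
  have g: "g = l *\<^sub>R f + d" by (simp add: d_def)
  have nd: "norm d < s" using fg(3) by (simp add: d_def)
  obtain h where h: "f = B g + \<gamma> h" "(h, \<gamma>s g) \<in> T" using fg(1) S_iff by blast
  have Bd: "norm (B d) \<le> s / a0"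
    using norm_B_le[of d] nd a0 by (smt (verit) divide_right_mono)
  have \<gamma>h: "\<gamma> h = (f - l *\<^sub>R B f) - B d" using h(1) by (simp add: g B.add B.scale algebra_simps)
  have "1 \<le> norm (f - l *\<^sub>R B f)"
  proof -
    have "1 \<le> (norm f)\<^sup>2 - l * (B f \<bullet> f)"
      using fg(2) l(2) B_nonneg[of f] by (simp add: mult_nonpos_nonneg)
    also have "\<dots> = (f - l *\<^sub>R B f) \<bullet> f" by (simp add: inner_diff_left power2_norm_eq_inner)
    also have "\<dots> \<le> norm (f - l *\<^sub>R B f)" using norm_cauchy_schwarz[of "f - l *\<^sub>R B f" f] fg(2) by simp
    finally show ?thesis .
  qed
  moreover have "s / a0 \<le> 1 / 2" using s(3) a0 by (simp add: field_simps)
  ultimately have "1 / 2 \<le> norm (\<gamma> h)"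
    using norm_triangle_ineq2[of "f - l *\<^sub>R B f" "B d"] Bd unfolding \<gamma>h by linarith
  then have "1 / 2 \<le> C * norm h" using C(2)[of h] by linarith
  then have lower: "1 / (2 * C) \<le> norm h" using C(1) by (simp add: field_simps)
  have "norm (\<gamma> h) \<le> norm f + norm (l *\<^sub>R B f) + norm (B d)"
    unfolding \<gamma>h using norm_triangle_ineq4[of "f - l *\<^sub>R B f" "B d"] norm_triangle_ineq4[of f "l *\<^sub>R B f"] by linarith
  also have "norm (l *\<^sub>R B f) \<le> \<bar>l\<bar> * (1 / a0)"
    using norm_B_le[of f] fg(2) by (simp add: mult_left_mono del: mult_1_right times_divide_eq_right)
  also have "norm (B d) \<le> 1 / a0" using Bd s(2) a0 by (smt (verit) divide_right_mono)
  finally have "norm (\<gamma> h) \<le> 1 + (\<bar>l\<bar> + 1) / a0" using fg(2) by (simp add: add_divide_distrib)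
  then have "c * norm h \<le> 1 + (\<bar>l\<bar> + 1) / a0" using c(2)[of h] by linarith
  then have upper: "norm h \<le> (1 + (\<bar>l\<bar> + 1) / a0) / c" using c(1) by (simp add: field_simps)
  have "list_form L h \<le> 2 * list_form (map p L) f + 2 * list_form (map q L) d"
  proof (rule list_form_split_le)
    fix \<phi>
    have "h \<bullet> \<phi> = \<gamma> h \<bullet> \<psi> \<phi>" by (simp add: adj \<psi>)
    also have "\<dots> = f \<bullet> \<psi> \<phi> - l * (f \<bullet> B (\<psi> \<phi>)) - d \<bullet> B (\<psi> \<phi>)"
      unfolding \<gamma>h by (simp add: inner_diff_left B_sym)
    finally show "h \<bullet> \<phi> = f \<bullet> p \<phi> - d \<bullet> q \<phi>" by (simp add: p_def q_def inner_diff_right)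
  qed
  also have "list_form (map q L) d \<le> K * s\<^sup>2"
  proof -
    have "K * (norm d)\<^sup>2 \<le> K * s\<^sup>2" using nd K(1) by (intro mult_left_mono power_mono) auto
    then show ?thesis using K(2)[of d] by linarith
  qed
  finally have q: "list_form L h \<le> (2 + 2 * K) * s\<^sup>2" using fg(4) by (simp add: algebra_simps)
  also have "\<dots> \<le> (2 + 2 * K) * s" using s K(1) by (intro mult_left_mono) (auto simp: power2_eq_square)
  finally have q: "list_form L h \<le> (2 + 2 * K) * s" .
  have "g \<bullet> f = l + d \<bullet> f" using fg(2) by (simp add: g inner_add_left dot_square_norm)
  also have "d \<bullet> f \<le> s" using norm_cauchy_schwarz[of d f] fg(2) nd by simp
  finally have "\<gamma>s g \<bullet> h \<le> l + s" using form_S[OF h(1)] B_nonneg[of g] by linarith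
  then have "b * (norm h)\<^sup>2 \<le> l + s * (3 + 2 * K)" using L[OF h(2)] q by (simp add: algebra_simps)
  then have "b * (norm h)\<^sup>2 \<le> l + e" using se by linarith
  with lower upper show ?thesis by blast
qed

lemma ess_spectrum_S_ge_nonneg:
  assumes "l \<in> sa_ess_spectrum S" "l \<le> 0" "T.form_bound b" "b \<ge> 0"
    and C: "C > 0" "\<And>h. norm (\<gamma> h) \<le> C * norm h"
  shows "b * (1 / (2 * C))\<^sup>2 \<le> l"
proof (rule field_le_epsilon)
  fix e :: real assume e: "e > 0"
  obtain c where c: "c > 0" "\<And>h. c * norm h \<le> norm (\<gamma> h)" using gamma_lower by blast
  obtain h :: 'b where h: "b * (norm h)\<^sup>2 \<le> l + e" "1 / (2 * C) \<le> norm h"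
    using ess_spectrum_S_approx[OF assms(1-3) C c e] by blast
  have "b * (1 / (2 * C))\<^sup>2 \<le> b * (norm h)\<^sup>2"
    using h(2) assms(4) C(1) by (intro mult_left_mono power_mono) auto
  with h(1) show "b * (1 / (2 * C))\<^sup>2 \<le> l + e" by linarith
qed

text \<open>For negative b it is the upper bound on h that matters; it depends on l, harmlessly,
  since l is fixed when b is chosen.\<close>

lemma ess_spectrum_S_ge_nonpos:
  assumes "l \<in> sa_ess_spectrum S" "l \<le> 0" "T.form_bound b" "b \<le> 0"
    and c: "c > 0" "\<And>h. c * norm h \<le> norm (\<gamma> h)"
  shows "b * ((1 + (\<bar>l\<bar> + 1) / a0) / c)\<^sup>2 \<le> l"
proof (rule field_le_epsilon)
  fix e :: real assume e: "e > 0"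
  obtain C where C: "C > 0" "\<And>h. norm (\<gamma> h) \<le> C * norm h" using gamma_upper by blast
  obtain h :: 'b where h: "b * (norm h)\<^sup>2 \<le> l + e" "norm h \<le> (1 + (\<bar>l\<bar> + 1) / a0) / c"
    using ess_spectrum_S_approx[OF assms(1-3) C c e] by blast
  have "b * ((1 + (\<bar>l\<bar> + 1) / a0) / c)\<^sup>2 \<le> b * (norm h)\<^sup>2"
    using h(2) assms(4) by (intro mult_left_mono_neg power_mono) auto
  with h(1) show "b * ((1 + (\<bar>l\<bar> + 1) / a0) / c)\<^sup>2 \<le> l + e" by linarith
qed

lemma form_bound_T:
  assumes "S.form_bound m"
  obtains m' where "T.form_bound m'"
proof -
  obtain C where C: "\<And>h. norm (\<gamma> h) \<le> C * norm h" using gamma_upper by blast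
  have "S.form_bound (min m 0)" using S.form_bound_mono[OF assms] by simp
  from form_bound_transfer_nonpos[OF this _ C] show ?thesis using that by simp
qed

section \<open>Comparison of the essential spectra at 0\<close>

theorem inf_ess_ge_0_iff:
  assumes "S.form_bound m"
  shows "inf_ess S \<ge> 0 \<longleftrightarrow> inf_ess T \<ge> 0"
proof
  obtain m' where m': "T.form_bound m'" using form_bound_T[OF assms] .
  obtain C where C: "C > 0" "\<And>h. norm (\<gamma> h) \<le> C * norm h" using gamma_upper by blast
  obtain c where c: "c > 0" "\<And>h. c * norm h \<le> norm (\<gamma> h)" using gamma_lower by blast
  {
    assume "inf_ess S \<ge> 0"
    then have S: "\<forall>a<0. \<exists>b>a. S.form_bound b" using S.inf_ess_ge_iff[OF assms, of 0] by (simp add: zero_ereal_def)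
    have "\<exists>b>a. T.form_bound b" if a: "a < 0" for a
    proof -
      \<comment> \<open>Anticipates the factor C^2 by which a negative bound is multiplied in the
        transfer.\<close>
      have "a / C\<^sup>2 < 0" using a C(1) by (simp add: divide_neg_pos)
      then obtain b where b: "a / C\<^sup>2 < b" "S.form_bound b" using S by blast
      show ?thesis
      proof (cases "b \<ge> 0")
        case True
        have "T.form_bound (b * c\<^sup>2)" by (rule form_bound_transfer_nonneg[OF b(2) True c])
        moreover have "a < b * c\<^sup>2" using a True by (smt (verit) mult_nonneg_nonneg zero_le_power2)
        ultimately show ?thesis by blast
      next
        case False
        then have "T.form_bound (b * C\<^sup>2)" using form_bound_transfer_nonpos[OF b(2) _ C(2)] by simp
        moreover have "a < b * C\<^sup>2" using b(1) C(1) by (simp add: field_simps)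
        ultimately show ?thesis by blast
      qed
    qed
    then show "inf_ess T \<ge> 0" using T.inf_ess_ge_iff[OF m', of 0] by (simp add: zero_ereal_def)
  next
    assume "inf_ess T \<ge> 0"
    then have T: "\<forall>a<0. \<exists>b>a. T.form_bound b" using T.inf_ess_ge_iff[OF m', of 0] by (simp add: zero_ereal_def)
    have "0 \<le> l" if l: "l \<in> sa_ess_spectrum S" for l
    proof (rule ccontr)
      assume "\<not> 0 \<le> l"
      then have l0: "l < 0" by simp
      \<comment> \<open>The square of the upper bound for h, so a negative b satisfies b V \<le> l;
        choosing b above l / V contradicts this.\<close>
      define V where "V = ((1 + (\<bar>l\<bar> + 1) / a0) / c)\<^sup>2"
      have "1 + (\<bar>l\<bar> + 1) / a0 > 0" using a0 by (simp add: add_pos_nonneg)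
      then have V: "V > 0" unfolding V_def using c(1) by (simp add: zero_less_power)
      have "l / V < 0" using l0 V by (simp add: divide_neg_pos)
      then obtain b where b: "l / V < b" "T.form_bound b" using T by blast
      show False
      proof (cases "b \<ge> 0")
        case True
        have "b * (1 / (2 * C))\<^sup>2 \<le> l"
          using ess_spectrum_S_ge_nonneg[OF l _ b(2) True C] l0 by simp
        then show False using l0 True by (smt (verit) mult_nonneg_nonneg zero_le_power2)
      next
        case False
        then have "b * V \<le> l" unfolding V_def
          using ess_spectrum_S_ge_nonpos[OF l _ b(2) _ c] l0 by simp
        then show False using b(1) V by (simp add: field_simps)
      qed
    qed
    then show "inf_ess S \<ge> 0" unfolding inf_ess_def by (intro Inf_greatest) auto
  }
qed

theorem inf_ess_gt_0_iff:
  assumes "S.form_bound m"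
  shows "inf_ess S > 0 \<longleftrightarrow> inf_ess T > 0"
proof
  obtain m' where m': "T.form_bound m'" using form_bound_T[OF assms] .
  obtain C where C: "C > 0" "\<And>h. norm (\<gamma> h) \<le> C * norm h" using gamma_upper by blast
  obtain c where c: "c > 0" "\<And>h. c * norm h \<le> norm (\<gamma> h)" using gamma_lower by blast
  {
    assume "inf_ess S > 0"
    then obtain b where b: "b > 0" "S.form_bound b"
      using S.inf_ess_greater_iff[OF assms, of 0] by (auto simp: zero_ereal_def)
    then have "T.form_bound (b * c\<^sup>2)" using form_bound_transfer_nonneg[OF b(2) _ c] by simp
    moreover have "b * c\<^sup>2 > 0" using b(1) c(1) by simp
    ultimately show "inf_ess T > 0"
      using T.inf_ess_greater_iff[OF m', of 0] by (auto simp: zero_ereal_def)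
  next
    assume "inf_ess T > 0"
    then obtain b where b: "b > 0" "T.form_bound b"
      using T.inf_ess_greater_iff[OF m', of 0] by (auto simp: zero_ereal_def)
    have "l \<notin> sa_ess_spectrum S" if "l \<le> 0" for l
    proof
      assume "l \<in> sa_ess_spectrum S"
      then have "b * (1 / (2 * C))\<^sup>2 \<le> l"
        using ess_spectrum_S_ge_nonneg[OF _ that b(2) _ C] b(1) by simp
      moreover have "b * (1 / (2 * C))\<^sup>2 > 0" using b(1) C(1) by simp
      ultimately show False using that by linarith
    qed
    then show "inf_ess S > 0" using S.inf_ess_greaterI[OF assms, of 0] by (simp add: zero_ereal_def)
  }
qed

end

section \<open>Boundary triplets\<close>

lemma Re_cinner [simp]: "Re (cinner J x y) = x \<bullet> y"
  by (simp add: cinner_def)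

lemma cinner_eq_iff: "cinner J a b = cinner J c d \<longleftrightarrow> a \<bullet> b = c \<bullet> d \<and> J a \<bullet> b = J c \<bullet> d"
  by (simp add: cinner_def)

text \<open>Stability under J makes the imaginary part of the complex identity another instance of
  the real one, so complex and real adjoint agree.\<close>

lemma radj_real:
  assumes "\<And>f g. (f, g) \<in> T \<Longrightarrow> (J f, J g) \<in> T"
  shows "(a, b) \<in> radj J T \<longleftrightarrow> (\<forall>f g. (f, g) \<in> T \<longrightarrow> g \<bullet> a = f \<bullet> b)"
  unfolding radj_def cinner_eq_iff using assms by blast

lemma self_adjoint_rel_imp_sa_relation:
  assumes "lin_rel J T" "self_adjoint_rel J T"
  shows "sa_relation T"
proof
  fix a b
  have "(a, b) \<in> T \<longleftrightarrow> (a, b) \<in> radj J T" using assms(2) by (simp add: self_adjoint_rel_def)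
  also have "\<dots> \<longleftrightarrow> (\<forall>f g. (f, g) \<in> T \<longrightarrow> g \<bullet> a = f \<bullet> b)"
    using assms(1) by (intro radj_real) (auto simp: lin_rel_def)
  finally show "(a, b) \<in> T \<longleftrightarrow> (\<forall>f g. (f, g) \<in> T \<longrightarrow> g \<bullet> a = f \<bullet> b)" .
qed

text \<open>The shear (f, g) to (f, g + M f) preserves the pairing that defines the adjoint, because
  the two terms with M cancel.\<close>

lemma sa_relation_rel_minus:
  assumes "sa_relation Th" and M: "\<And>x y. M x \<bullet> y = x \<bullet> M y"
  shows "sa_relation (rel_minus Th {(h, M h) | h. True})"
proof -
  interpret sa_relation Th by fact
  have mem: "(f, g) \<in> rel_minus Th {(h, M h) | h. True} \<longleftrightarrow> (f, g + M f) \<in> Th" for f g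
    by (force simp: rel_minus_def)
  show ?thesis
  proof
    fix a b
    have "(a, b + M a) \<in> Th \<longleftrightarrow> (\<forall>f g. (f, g + M f) \<in> Th \<longrightarrow> (g + M f) \<bullet> a = f \<bullet> (b + M a))"
      unfolding mem_iff[of a] by (metis diff_add_cancel)
    then show "(a, b) \<in> rel_minus Th {(h, M h) | h. True} \<longleftrightarrow>
        (\<forall>f g. (f, g) \<in> rel_minus Th {(h, M h) | h. True} \<longrightarrow> g \<bullet> a = f \<bullet> b)"
      unfolding mem by (simp add: inner_add_left inner_add_right M)
  qed
qed

locale boundary_triplet_setting =
  fixes J :: "'a::{real_inner, complete_space} \<Rightarrow> 'a"
    and K :: "'b::{real_inner, complete_space} \<Rightarrow> 'b"
    and A :: "('a \<times> 'a) set" and G0 G1 :: "'a \<Rightarrow> 'b" and a0 :: real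
  assumes A: "cdds_operator J A"
    and a0: "a0 > 0" and A_ge: "bounded_below_by J A a0"
    and triplet: "boundary_triplet J K A G0 G1"
    and friedrichs: "ext_A0 J A G0 = friedrichs J A"
begin

abbreviation "As \<equiv> radj J A"
abbreviation "A0 \<equiv> ext_A0 J A G0"

lemma As_iff: "(a, b) \<in> As \<longleftrightarrow> (\<forall>f g. (f, g) \<in> A \<longrightarrow> g \<bullet> a = f \<bullet> b)"
  using A by (intro radj_real) (auto simp: cdds_operator_def lin_rel_def)

lemma As_add: "(f, g) \<in> As \<Longrightarrow> (f', g') \<in> As \<Longrightarrow> (f + f', g + g') \<in> As"
  by (simp add: As_iff inner_add_right)

lemma As_scale: "(f, g) \<in> As \<Longrightarrow> (c *\<^sub>R f, c *\<^sub>R g) \<in> As"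
  by (simp add: As_iff)

lemma As_diff: "(f, g) \<in> As \<Longrightarrow> (f', g') \<in> As \<Longrightarrow> (f - f', g - g') \<in> As"
  by (simp add: As_iff inner_diff_right)

lemma A_subset_As: "A \<subseteq> As"
  using A by (simp add: cdds_operator_def symmetric_rel_def)

lemma As_dom: "(f, g) \<in> As \<Longrightarrow> f \<in> rdom As"
  by (force simp: rdom_def)

lemma G_add:
  assumes "f \<in> rdom As" "g \<in> rdom As"
  shows "G0 (f + g) = G0 f + G0 g" "G1 (f + g) = G1 f + G1 g"
  using triplet assms by (auto simp: boundary_triplet_def clinear_on_def)

lemma G_scale:
  assumes "f \<in> rdom As"
  shows "G0 (c *\<^sub>R f) = c *\<^sub>R G0 f" "G1 (c *\<^sub>R f) = c *\<^sub>R G1 f"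
proof -
  have "G0 (cscale J (of_real c) f) = cscale K (of_real c) (G0 f)"
    "G1 (cscale J (of_real c) f) = cscale K (of_real c) (G1 f)"
    using triplet assms unfolding boundary_triplet_def clinear_on_def by blast+
  then show "G0 (c *\<^sub>R f) = c *\<^sub>R G0 f" "G1 (c *\<^sub>R f) = c *\<^sub>R G1 f" by (simp_all add: cscale_def)
qed

lemma rdom_As_scale: "f \<in> rdom As \<Longrightarrow> c *\<^sub>R f \<in> rdom As"
  using As_scale by (force simp: rdom_def)

lemma G_diff:
  assumes "f \<in> rdom As" "g \<in> rdom As"
  shows "G0 (f - g) = G0 f - G0 g" "G1 (f - g) = G1 f - G1 g"
  using G_add[OF assms(1) rdom_As_scale[OF assms(2), of "-1"]] G_scale[OF assms(2), of "-1"] by simp_all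

lemma green: "(f, f') \<in> As \<Longrightarrow> (g, g') \<in> As \<Longrightarrow> f' \<bullet> g - f \<bullet> g' = G1 f \<bullet> G0 g - G0 f \<bullet> G1 g"
proof -
  assume "(f, f') \<in> As" "(g, g') \<in> As"
  then have "cinner J f' g - cinner J f g' = cinner K (G1 f) (G0 g) - cinner K (G0 f) (G1 g)"
    using triplet unfolding boundary_triplet_def by blast
  from arg_cong[OF this, of Re] show ?thesis by simp
qed

lemma G_surj: obtains f f' where "(f, f') \<in> As" "G0 f = x" "G1 f = y"
proof -
  have "(x, y) \<in> (\<lambda>f. (G0 f, G1 f)) ` rdom As" using triplet by (auto simp: boundary_triplet_def)
  then show ?thesis using that by (auto simp: rdom_def)
qed

text \<open>Against A the left side of Green's identity vanishes, while the boundary values of the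
  other vector are arbitrary.\<close>

lemma G_on_A:
  assumes "(f, g) \<in> A"
  shows "G0 f = 0" "G1 f = 0"
proof -
  have *: "G1 f \<bullet> x = G0 f \<bullet> y" for x y
  proof -
    obtain h h' where h: "(h, h') \<in> As" "G0 h = x" "G1 h = y" using G_surj .
    have "(f, g) \<in> As" using assms A_subset_As by blast
    from green[OF this h(1)] h assms show ?thesis by (simp add: As_iff)
  qed
  have "G1 f \<bullet> G1 f = 0" using *[of "G1 f" 0] by simp
  then show "G1 f = 0" by simp
  have "G0 f \<bullet> G0 f = 0" using *[of 0 "G0 f"] by simp
  then show "G0 f = 0" by simp
qed

text \<open>Green's identity carries symmetry of Th to the extension. Conversely, a pair in the
  adjoint of the extension lies in that of A; since all of Th is attained by boundary values,
  Green's identity puts its own boundary values into the adjoint of Th.\<close>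

lemma ext_sa_relation:
  assumes "sa_relation Th"
  shows "sa_relation (ext_Theta J A G0 G1 Th)"
proof -
  interpret Th: sa_relation Th by fact
  have mem: "(f, g) \<in> ext_Theta J A G0 G1 Th \<longleftrightarrow> (f, g) \<in> As \<and> (G0 f, G1 f) \<in> Th" for f g
    by (simp add: ext_Theta_def)
  show ?thesis
  proof
    fix a b
    show "(a, b) \<in> ext_Theta J A G0 G1 Th \<longleftrightarrow>
        (\<forall>f g. (f, g) \<in> ext_Theta J A G0 G1 Th \<longrightarrow> g \<bullet> a = f \<bullet> b)"
    proof
      assume ab: "(a, b) \<in> ext_Theta J A G0 G1 Th"
      show "\<forall>f g. (f, g) \<in> ext_Theta J A G0 G1 Th \<longrightarrow> g \<bullet> a = f \<bullet> b"
      proof (intro allI impI)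
        fix f g assume fg: "(f, g) \<in> ext_Theta J A G0 G1 Th"
        have "G1 f \<bullet> G0 a = G0 f \<bullet> G1 a" using Th.symm fg ab mem by blast
        then show "g \<bullet> a = f \<bullet> b" using green[of f g a b] fg ab mem by simp
      qed
    next
      assume *: "\<forall>f g. (f, g) \<in> ext_Theta J A G0 G1 Th \<longrightarrow> g \<bullet> a = f \<bullet> b"
      have "A \<subseteq> ext_Theta J A G0 G1 Th" using A_subset_As G_on_A Th.zero_mem mem by auto
      then have ab: "(a, b) \<in> As" unfolding As_iff using * by blast
      have "y \<bullet> G0 a = x \<bullet> G1 a" if "(x, y) \<in> Th" for x y
      proof -
        obtain h h' where h: "(h, h') \<in> As" "G0 h = x" "G1 h = y" using G_surj .
        then have "h' \<bullet> a = h \<bullet> b" using * mem that by blast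
        then show ?thesis using green[OF h(1) ab] h by simp
      qed
      then have "(G0 a, G1 a) \<in> Th" unfolding Th.mem_iff[of "G0 a"] by blast
      with ab show "(a, b) \<in> ext_Theta J A G0 G1 Th" using mem by blast
    qed
  qed
qed

lemma A0_eq_ext: "A0 = ext_Theta J A G0 G1 ({0} \<times> UNIV)"
  by (auto simp: ext_A0_def ext_Theta_def)

lemma A0_iff: "(f, g) \<in> A0 \<longleftrightarrow> (f, g) \<in> As \<and> G0 f = 0"
  by (simp add: ext_A0_def)

lemma A0_sa: "sa_relation A0"
  unfolding A0_eq_ext
proof (rule ext_sa_relation, unfold_locales)
  show "((a::'b, b::'b) \<in> {0} \<times> UNIV) \<longleftrightarrow> (\<forall>f g. (f, g) \<in> {0} \<times> UNIV \<longrightarrow> g \<bullet> a = f \<bullet> b)" for a b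
    by (auto simp: inner_eq_zero_iff dest: spec[of _ a])
qed

text \<open>The Friedrichs condition is applied with the same approximating sequence in both
  arguments, which gives convergence of the energy.\<close>

lemma A0_form_approx:
  assumes "(f, g) \<in> A0"
  obtains p where "form_approx J A f p" "(\<lambda>n. snd (p n) \<bullet> fst (p n)) \<longlonglongrightarrow> g \<bullet> f"
proof -
  have fr: "(f, g) \<in> friedrichs J A" using assms friedrichs by simp
  then obtain p where p: "form_approx J A f p" unfolding friedrichs_def by blast
  then have "(\<lambda>n. cinner J (snd (p n)) (fst (p n))) \<longlonglongrightarrow> cinner J g f"
    using fr unfolding friedrichs_def by blast
  from tendsto_Re[OF this] show ?thesis using that p by simp
qed

lemma A0_ge: assumes "(f, g) \<in> A0" shows "a0 * (norm f)\<^sup>2 \<le> g \<bullet> f"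
proof -
  obtain p where p: "form_approx J A f p" "(\<lambda>n. snd (p n) \<bullet> fst (p n)) \<longlonglongrightarrow> g \<bullet> f"
    using A0_form_approx[OF assms] .
  have f: "(\<lambda>n. fst (p n)) \<longlonglongrightarrow> f" and pA: "\<And>n. p n \<in> A" using p(1) by (auto simp: form_approx_def)
  have "(\<lambda>n. a0 * (norm (fst (p n)))\<^sup>2) \<longlonglongrightarrow> a0 * (norm f)\<^sup>2"
    by (intro tendsto_mult tendsto_power tendsto_norm tendsto_const f)
  moreover have "a0 * (norm (fst (p n)))\<^sup>2 \<le> snd (p n) \<bullet> fst (p n)" for n
    using A_ge pA[of n] unfolding bounded_below_by_def Re_cinner by (metis prod.collapse)
  ultimately show ?thesis using p(2) LIMSEQ_le by blast
qed

section \<open>The Friedrichs inverse, the \<gamma>-field and Krein's formula\<close>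

definition B :: "'a \<Rightarrow> 'a" where "B u = (SOME f. (f, u) \<in> A0)"

lemma A0_unique: assumes "(f, u) \<in> A0" "(f', u) \<in> A0" shows "f = f'"
proof -
  interpret sa_relation A0 by (rule A0_sa)
  have "a0 * (norm (f - f'))\<^sup>2 \<le> 0" using A0_ge[OF diff_mem[OF assms]] by simp
  then show ?thesis using a0 by (simp add: mult_le_0_iff)
qed

lemma B: "(B u, u) \<in> A0"
proof -
  interpret sa_relation A0 by (rule A0_sa)
  have "a0 * norm f \<le> norm g" if "(f, g) \<in> A0" for f g
  proof (cases "f = 0")
    case False
    have "a0 * (norm f)\<^sup>2 \<le> norm g * norm f" using A0_ge[OF that] norm_cauchy_schwarz[of g f] by linarith
    then have "(a0 * norm f) * norm f \<le> norm g * norm f" by (simp add: power2_eq_square)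
    then show ?thesis using False by simp
  qed simp
  then have "regular_at 0" unfolding regular_at_def using a0 by auto
  then obtain f where "(f, u + 0 *\<^sub>R f) \<in> A0" using surj_if_regular by blast
  then show ?thesis unfolding B_def by (metis scaleR_zero_left add_0_right someI_ex)
qed

lemma B_eq: "(f, u) \<in> A0 \<Longrightarrow> B u = f"
  using A0_unique B by blast

lemma B_As: "(B u, u) \<in> As" and G0_B: "G0 (B u) = 0"
  using B[of u] by (simp_all add: A0_iff)

lemma linear_B: "linear B"
proof -
  interpret sa_relation A0 by (rule A0_sa)
  show ?thesis by (rule linearI) (intro B_eq add_mem scale_mem B)+
qed

definition \<gamma> :: "'b \<Rightarrow> 'a" where "\<gamma> h = (SOME f. (f, 0) \<in> As \<and> G0 f = h)"

text \<open>Any f with G0 f = h can be corrected by B f', which removes the image under the adjoint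
  and leaves G0 unchanged.\<close>

lemma gamma: "(\<gamma> h, 0) \<in> As" "G0 (\<gamma> h) = h"
proof -
  obtain f f' where f: "(f, f') \<in> As" "G0 f = h" using G_surj .
  have "(f - B f', f' - f') \<in> As" by (rule As_diff[OF f(1) B_As])
  moreover have "G0 (f - B f') = h" using G_diff(1)[OF As_dom[OF f(1)] As_dom[OF B_As]] f(2) G0_B by simp
  ultimately have "(f - B f', 0) \<in> As \<and> G0 (f - B f') = h" by simp
  then have "(\<gamma> h, 0) \<in> As \<and> G0 (\<gamma> h) = h" unfolding \<gamma>_def by (rule someI)
  then show "(\<gamma> h, 0) \<in> As" "G0 (\<gamma> h) = h" by blast+
qed

text \<open>The domain of the adjoint is the sum of dom A0 and its kernel; the leftover d lies in
  the kernel of A0, which is trivial by a0 > 0.\<close>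

lemma As_decomp: assumes "(f, g) \<in> As" shows "f = B g + \<gamma> (G0 f)"
proof -
  define d where "d = f - B g - \<gamma> (G0 f)"
  have "(d, g - g - 0) \<in> As" unfolding d_def by (intro As_diff assms B_As gamma)
  moreover have "G0 d = 0"
    unfolding d_def using G_diff(1)[OF As_dom[OF As_diff[OF assms B_As]] As_dom[OF gamma(1)]]
      G_diff(1)[OF As_dom[OF assms] As_dom[OF B_As]] by (simp add: G0_B gamma(2))
  ultimately have "(d, 0) \<in> A0" by (simp add: A0_iff)
  then have "a0 * (norm d)\<^sup>2 \<le> 0" using A0_ge by fastforce
  then have "d = 0" using a0 by (simp add: mult_le_0_iff)
  then show ?thesis by (simp add: d_def algebra_simps)
qed

lemma gamma_adjoint: "\<gamma> h \<bullet> g = h \<bullet> G1 (B g)"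
  using green[OF gamma(1)[of h] B_As[of g]] by (simp add: G0_B gamma(2))

lemma weyl0_eq: "weyl0 J A G0 G1 = {(h, G1 (\<gamma> h)) | h. True}"
proof -
  have "f = \<gamma> (G0 f)" if "(f, 0) \<in> As" for f
    using As_decomp[OF that] linear_0[OF linear_B] by simp
  then show ?thesis unfolding weyl0_def using gamma by (auto; metis)
qed

lemma weyl0_symmetric: "G1 (\<gamma> h) \<bullet> h' = h \<bullet> G1 (\<gamma> h')"
  using green[OF gamma(1)[of h] gamma(1)[of h']] by (simp add: gamma(2))

lemma boundary_values_decomp:
  shows "G0 (B g + \<gamma> h) = h" "G1 (B g + \<gamma> h) = G1 (B g) + G1 (\<gamma> h)" "(B g + \<gamma> h, g) \<in> As"
  using G_add[OF As_dom[OF B_As[of g]] As_dom[OF gamma(1)[of h]]] As_add[OF B_As[of g] gamma(1)[of h]]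
  by (simp_all add: G0_B gamma(2))

text \<open>With f = B g + \<gamma> h one has G0 f = h and G1 f = G1 (B g) + M(0) h, so the boundary
  condition Th becomes a condition of Th - M(0) on (h, G1 (B g)).\<close>

lemma krein_formula:
  "(f, g) \<in> ext_Theta J A G0 G1 Th \<longleftrightarrow>
    (\<exists>h. f = B g + \<gamma> h \<and> (h, G1 (B g)) \<in> rel_minus Th (weyl0 J A G0 G1))"
proof -
  have mem: "(h, k) \<in> rel_minus Th (weyl0 J A G0 G1) \<longleftrightarrow> (h, k + G1 (\<gamma> h)) \<in> Th" for h k
    unfolding weyl0_eq by (force simp: rel_minus_def)
  show ?thesis
  proof
    assume "(f, g) \<in> ext_Theta J A G0 G1 Th"
    then have fg: "(f, g) \<in> As" "(G0 f, G1 f) \<in> Th" by (simp_all add: ext_Theta_def)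
    have f: "f = B g + \<gamma> (G0 f)" by (rule As_decomp[OF fg(1)])
    then have "G1 f = G1 (B g) + G1 (\<gamma> (G0 f))" using boundary_values_decomp(2) by metis
    then show "\<exists>h. f = B g + \<gamma> h \<and> (h, G1 (B g)) \<in> rel_minus Th (weyl0 J A G0 G1)"
      using f fg(2) mem by auto
  next
    assume "\<exists>h. f = B g + \<gamma> h \<and> (h, G1 (B g)) \<in> rel_minus Th (weyl0 J A G0 G1)"
    then show "(f, g) \<in> ext_Theta J A G0 G1 Th" unfolding mem ext_Theta_def by (auto simp: boundary_values_decomp)
  qed
qed

text \<open>Pick f in dom A0 with G1 f = k. Its form approximants lie in dom A, where both boundary
  maps vanish, so subtracting them keeps G1 equal to k while the remaining energy tends to
  0.\<close>

lemma friedrichs_small: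
  assumes "e > 0"
  shows "\<exists>g. G1 (B g) = k \<and> B g \<bullet> g < e"
proof -
  obtain f f' where f: "(f, f') \<in> As" "G0 f = 0" "G1 f = k" using G_surj .
  then have fA0: "(f, f') \<in> A0" by (simp add: A0_iff)
  obtain p where p: "form_approx J A f p" "(\<lambda>n. snd (p n) \<bullet> fst (p n)) \<longlonglongrightarrow> f' \<bullet> f"
    using A0_form_approx[OF fA0] .
  have flim: "(\<lambda>n. fst (p n)) \<longlonglongrightarrow> f" and pA: "\<And>n. (fst (p n), snd (p n)) \<in> A"
    using p(1) by (auto simp: form_approx_def)
  define g where "g n = f' - snd (p n)" for n
  have A_A0: "(fst (p n), snd (p n)) \<in> A0" for n
    unfolding A0_iff using subsetD[OF A_subset_As pA] G_on_A(1)[OF pA] by (intro conjI)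
  interpret A0: sa_relation A0 by (rule A0_sa)
  have Bg: "B (g n) = f - fst (p n)" for n
    unfolding g_def by (intro B_eq A0.diff_mem fA0 A_A0)
  \<comment> \<open>The sequence is the energy of f - fst (p n) expanded by symmetry of A0; the last
    term converges by the Friedrichs property.\<close>
  have "(\<lambda>n. f' \<bullet> f - 2 * (f' \<bullet> fst (p n)) + snd (p n) \<bullet> fst (p n)) \<longlonglongrightarrow> f' \<bullet> f - 2 * (f' \<bullet> f) + f' \<bullet> f"
    by (intro tendsto_add tendsto_diff tendsto_mult tendsto_inner tendsto_const flim p(2))
  moreover have "B (g n) \<bullet> g n = f' \<bullet> f - 2 * (f' \<bullet> fst (p n)) + snd (p n) \<bullet> fst (p n)" for n
    using A0.symm[OF fA0 A_A0, of n] unfolding Bg unfolding g_def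
    by (simp add: inner_diff_left inner_diff_right inner_commute)
  ultimately have "(\<lambda>n. B (g n) \<bullet> g n) \<longlonglongrightarrow> 0" by simp
  then have "eventually (\<lambda>n. B (g n) \<bullet> g n < e) sequentially" using assms by (rule order_tendstoD)
  then obtain n where n: "B (g n) \<bullet> g n < e" by (auto simp: eventually_sequentially)
  have "G1 (B (g n)) = k"
  proof -
    have "fst (p n) \<in> rdom As" using A_A0[of n] unfolding A0_iff by (blast intro: As_dom)
    then show ?thesis unfolding Bg using G_diff(2)[OF As_dom[OF f(1)]] G_on_A(2)[OF pA] f(3) by simp
  qed
  with n show ?thesis by blast
qed

lemma krein_pair:
  assumes "sa_relation Th"
  shows "krein_pair (ext_Theta J A G0 G1 Th) (rel_minus Th (weyl0 J A G0 G1)) B \<gamma> (\<lambda>g. G1 (B g)) a0"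
proof -
  interpret A0: sa_relation A0 by (rule A0_sa)
  interpret S: sa_relation "ext_Theta J A G0 G1 Th" by (rule ext_sa_relation[OF assms])
  interpret T: sa_relation "rel_minus Th (weyl0 J A G0 G1)"
    unfolding weyl0_eq by (rule sa_relation_rel_minus[OF assms weyl0_symmetric])
  show ?thesis
  proof (intro krein_pair.intro krein_pair_axioms.intro S.sa_relation_axioms T.sa_relation_axioms)
    show "(f, g) \<in> ext_Theta J A G0 G1 Th \<longleftrightarrow>
        (\<exists>h. f = B g + \<gamma> h \<and> (h, G1 (B g)) \<in> rel_minus Th (weyl0 J A G0 G1))" for f g
      by (rule krein_formula)
    show "linear B" by (rule linear_B)
    show "B u \<bullet> v = u \<bullet> B v" for u v using A0.symm[OF B[of u] B[of v]] by simp
    show "a0 > 0" by (rule a0)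
    show "a0 * (norm (B u))\<^sup>2 \<le> B u \<bullet> u" for u using A0_ge[OF B[of u]] by (simp add: inner_commute)
    show "\<gamma> h \<bullet> g = h \<bullet> G1 (B g)" for h g by (rule gamma_adjoint)
    show "\<And>e k. 0 < e \<Longrightarrow> \<exists>g. G1 (B g) = k \<and> B g \<bullet> g < e" by (rule friedrichs_small)
  qed
qed

end

theorem mainTheorem19:
  fixes J :: "'a::{real_inner, complete_space} \<Rightarrow> 'a"
    and K :: "'b::{real_inner, complete_space} \<Rightarrow> 'b"
    and A :: "('a \<times> 'a) set"
    and G0 G1 :: "'a \<Rightarrow> 'b"
    and Th :: "('b \<times> 'b) set"
    and a0 :: real
  assumes "cplx_str J" and "cplx_str K"
    and "separable_type TYPE('a)"
    and "cdds_operator J A"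
    and "equal_deficiency J A"
    and "a0 > 0" and "bounded_below_by J A a0"
    and "boundary_triplet J K A G0 G1"
    and "ext_A0 J A G0 = friedrichs J A"
    and "lin_rel K Th" and "closed Th" and "self_adjoint_rel K Th"
    and "lower_semibounded J (ext_Theta J A G0 G1 Th)"
  shows "(inf_ess (ext_Theta J A G0 G1 Th) \<ge> 0 \<longleftrightarrow> inf_ess (rel_minus Th (weyl0 J A G0 G1)) \<ge> 0)
    \<and> (inf_ess (ext_Theta J A G0 G1 Th) > 0 \<longleftrightarrow> inf_ess (rel_minus Th (weyl0 J A G0 G1)) > 0)
    \<and> (inf_ess (ext_Theta J A G0 G1 Th) = 0 \<longleftrightarrow> inf_ess (rel_minus Th (weyl0 J A G0 G1)) = 0)"
proof -
  interpret boundary_triplet_setting J K A G0 G1 a0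
    using assms by unfold_locales
  interpret krein_pair "ext_Theta J A G0 G1 Th" "rel_minus Th (weyl0 J A G0 G1)" B \<gamma> "\<lambda>g. G1 (B g)" a0
    by (rule krein_pair[OF self_adjoint_rel_imp_sa_relation[OF assms(10,12)]])
  obtain c where "bounded_below_by J (ext_Theta J A G0 G1 Th) c"
    using assms(13) unfolding lower_semibounded_def by blast
  then have "S.form_bound c"
    unfolding S.form_bound_def bounded_below_by_def Re_cinner
    by (intro exI[of _ "[]"]) simp
  \<comment> \<open>The third equivalence follows from the other two: the infimum is 0 iff it is
    nonnegative but not positive.\<close>
  from inf_ess_ge_0_iff[OF this] inf_ess_gt_0_iff[OF this] show ?thesis
    by (auto simp: order_le_less)
qed

end
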